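(* Let $m>0$, let $a\in H^2(\mathbb R)$ be real-valued, and set $$c=\cosh(2a),\qquad\eta=a'(c-1),\qquad A_a=\|\eta\|_2^2.$$ If $A_a>0$, define $$M_a=2\|\eta'\|_2^2+8m^2\|c\|_\infty\|\eta\|_2^2+8m\|a'\|_2\|\eta\|_4^2,\qquad \varepsilon_a=\min\Big\{\frac{2mA_a}{M_a},\frac{\pi}{4\|\eta\|_\infty}\Big\}.$$ Then $\delta_a=\varepsilon_a\eta$ satisfies $\|\delta_a\|_\infty\le\pi/4$ and $$\mathcal E_a[\delta_a]\le\mathcal E_a[0]-6mA_a\varepsilon_a.$$
   Context: For a real-valued phase $\delta\in H^1_{\rm loc}(\mathbb R)$, $$\mathcal E_a[\delta]=2\int_{\mathbb R}\Big[(\delta'+m\sinh(2a))^2+\big(m\cosh(2a)\cos(2\delta)-a'\sin(2\delta)-m\big)^2+\big(m\cosh(2a)\sin(2\delta)+a'\cos(2\delta)\big)^2\Big]dt.$$ Norms $\|\cdot\|_p$ are $L^p(\mathbb R)$ norms. *)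

theory Defs
  imports "HOL-Analysis.Analysis" "HOL-Probability.Essential_Supremum"
begin

text \<open>Elements of function spaces are represented by arbitrary Lebesgue measurable
  functions; all notions below are invariant under changes on null sets.\<close>

definition square_integrable :: "(real \<Rightarrow> real) \<Rightarrow> bool" where
  "square_integrable f \<longleftrightarrow>
     f \<in> borel_measurable lebesgue \<and> integrable lebesgue (\<lambda>t. (f t)\<^sup>2)"

definition loc_integrable :: "(real \<Rightarrow> real) \<Rightarrow> bool" where
  "loc_integrable f \<longleftrightarrow> (\<forall>K. compact K \<longrightarrow> set_integrable lebesgue K f)"

definition loc_square_integrable :: "(real \<Rightarrow> real) \<Rightarrow> bool" where
  "loc_square_integrable f \<longleftrightarrow>
     f \<in> borel_measurable lebesgue \<and>
     (\<forall>K. compact K \<longrightarrow> set_integrable lebesgue K (\<lambda>t. (f t)\<^sup>2))"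

definition test_function :: "(real \<Rightarrow> real) \<Rightarrow> bool" where
  "test_function \<phi> \<longleftrightarrow>
     (\<forall>n x. (deriv ^^ n) \<phi> field_differentiable at x) \<and> compact (closure {x. \<phi> x \<noteq> 0})"

definition has_weak_deriv :: "(real \<Rightarrow> real) \<Rightarrow> (real \<Rightarrow> real) \<Rightarrow> bool" where
  "has_weak_deriv f g \<longleftrightarrow>
     loc_integrable f \<and> loc_integrable g \<and>
     (\<forall>\<phi>. test_function \<phi> \<longrightarrow>
        (LINT t|lebesgue. f t * deriv \<phi> t) = - (LINT t|lebesgue. g t * \<phi> t))"

text \<open>A weak derivative is determined only almost everywhere; \<open>weak_deriv\<close> picks a
  representative, and is unspecified if there is none.\<close>

definition weak_deriv :: "(real \<Rightarrow> real) \<Rightarrow> real \<Rightarrow> real" where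
  "weak_deriv f = (SOME g. has_weak_deriv f g)"

primrec sobolev_H :: "nat \<Rightarrow> (real \<Rightarrow> real) \<Rightarrow> bool" where
  "sobolev_H 0 f \<longleftrightarrow> square_integrable f"
| "sobolev_H (Suc k) f \<longleftrightarrow> square_integrable f \<and> (\<exists>g. has_weak_deriv f g \<and> sobolev_H k g)"

definition sobolev_H1_loc :: "(real \<Rightarrow> real) \<Rightarrow> bool" where
  "sobolev_H1_loc f \<longleftrightarrow>
     loc_square_integrable f \<and> (\<exists>g. has_weak_deriv f g \<and> loc_square_integrable g)"

text \<open>For finite \<open>p\<close> the norm is real-valued and only meaningful for \<open>f\<close> in \<open>L\<^sup>p\<close>
  (otherwise the Bochner integral is 0). The supremum norm is extended real-valued, so
  that an upper bound on it entails essential boundedness.\<close>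

definition Lp_norm :: "real \<Rightarrow> (real \<Rightarrow> real) \<Rightarrow> real" where
  "Lp_norm p f = (LINT t|lebesgue. \<bar>f t\<bar> powr p) powr (1 / p)"

definition Linf_norm :: "(real \<Rightarrow> real) \<Rightarrow> ereal" where
  "Linf_norm f = esssup lebesgue (\<lambda>t. ereal \<bar>f t\<bar>)"

text \<open>The energy of a phase \<open>d\<close> in \<open>H\<^sup>1\<^sub>l\<^sub>o\<^sub>c\<close>. The integrand is nonnegative, so the
  energy is a well-defined element of \<open>[0, \<infinity>]\<close>.\<close>

definition energy :: "real \<Rightarrow> (real \<Rightarrow> real) \<Rightarrow> (real \<Rightarrow> real) \<Rightarrow> ereal" where
  "energy m a d = 2 * enn2ereal (\<integral>\<^sup>+ t. ennreal (
       (weak_deriv d t + m * sinh (2 * a t))\<^sup>2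
     + (m * cosh (2 * a t) * cos (2 * d t) - weak_deriv a t * sin (2 * d t) - m)\<^sup>2
     + (m * cosh (2 * a t) * sin (2 * d t) + weak_deriv a t * cos (2 * d t))\<^sup>2) \<partial>lebesgue)"

definition c_fun :: "(real \<Rightarrow> real) \<Rightarrow> real \<Rightarrow> real" where
  "c_fun a t = cosh (2 * a t)"

definition eta :: "(real \<Rightarrow> real) \<Rightarrow> real \<Rightarrow> real" where
  "eta a t = weak_deriv a t * (c_fun a t - 1)"

definition A_const :: "(real \<Rightarrow> real) \<Rightarrow> real" where
  "A_const a = (Lp_norm 2 (eta a))\<^sup>2"

definition M_const :: "real \<Rightarrow> (real \<Rightarrow> real) \<Rightarrow> real" where
  "M_const m a =
     2 * (Lp_norm 2 (weak_deriv (eta a)))\<^sup>2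
     + 8 * m\<^sup>2 * real_of_ereal (Linf_norm (c_fun a)) * (Lp_norm 2 (eta a))\<^sup>2
     + 8 * m * Lp_norm 2 (weak_deriv a) * (Lp_norm 4 (eta a))\<^sup>2"

definition eps_const :: "real \<Rightarrow> (real \<Rightarrow> real) \<Rightarrow> real" where
  "eps_const m a =
     min (2 * m * A_const a / M_const m a) (pi / (4 * real_of_ereal (Linf_norm (eta a))))"

definition delta :: "real \<Rightarrow> (real \<Rightarrow> real) \<Rightarrow> real \<Rightarrow> real" where
  "delta m a t = eps_const m a * eta a t"

end

theory Submission
  imports Defs "HOL-Computational_Algebra.Polynomial"
begin

text \<open>
  Write \<open>c = cosh 2a\<close>, \<open>s = sinh 2a\<close>, \<open>p = a'\<close>. Since \<open>cos\<^sup>2 + sin\<^sup>2 = 1\<close>, the energy density of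
  a phase \<open>\<delta>\<close> exceeds that of \<open>0\<close> by exactly
  \<open>\<delta>'\<^sup>2 + 2ms\<delta>' + 2m\<^sup>2c(1 - cos 2\<delta>) + 2mp sin 2\<delta>\<close>. Integrating by parts, \<open>\<integral>s\<delta>' = -2\<integral>cp\<delta>\<close>, so the
  terms linear in \<open>\<delta>\<close> add up to \<open>-4m\<integral>\<eta>\<delta>\<close>, which is \<open>-4m\<epsilon>A\<close> for \<open>\<delta> = \<epsilon>\<eta>\<close>. With
  \<open>1 - cos 2\<delta> \<le> 2\<delta>\<^sup>2\<close>, \<open>\<bar>sin 2\<delta> - 2\<delta>\<bar> \<le> 2\<delta>\<^sup>2\<close> and the Cauchy-Schwarz inequality, the energy changes by
  at most \<open>\<epsilon>\<^sup>2M - 8m\<epsilon>A\<close>, and \<open>\<epsilon>M \<le> 2mA\<close>.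

  The analysis behind this is that \<open>a\<close> and \<open>a'\<close> have representatives that are indefinite Lebesgue
  integrals of their weak derivatives; for those, Fubini's theorem on a triangle gives
  the product rule.
\<close>

section \<open>Smooth bump functions and the fundamental lemma\<close>

text \<open>The direction \<open>eta\<close> is that of steepest descent in L^2 at the zero phase:
  the part of the energy linear in the phase is \<open>- 8 * m\<close> times its inner product with
  \<open>eta\<close>. Along \<open>eps * eta\<close> the bound
  \<open>eps^2 * M - 8 * m * eps * A\<close> is smallest at \<open>4 * m * A / M\<close>; the first
  entry of the minimum is half of that, so the quadratic term costs at most
  \<open>2 * m * eps * A\<close>. The second entry is the largest amplitude compatible with the sup
  bound. Two obstacles shape the proof. Weak derivatives are arbitrary representatives picked by
  \<open>SOME\<close>, so pointwise calculus takes place on continuous representatives and is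
  transferred almost everywhere. And default values are everywhere: a Bochner integral without
  integrability is 0, \<open>real_of_ereal\<close> of an infinity is 0, a quotient by 0 is 0.
  Integrability, finiteness and positivity are therefore established before a constant or an
  integral is used. Integration by parts on the line also has boundary terms at infinity;
  integrability of the product removes them, with no decay estimate.\<close>

text \<open>One term of the series of \<open>exp (e * x)\<close> is at most the whole sum. With
  \<open>x\<close> the reciprocal of a small quantity, this says that the exponential factor of a
  bump beats every pole.\<close>

lemma power_times_exp_le:
  fixes x e :: real
  assumes "x \<ge> 0" "e > 0"
  shows "x ^ n * exp (- (e * x)) \<le> fact n / e ^ n"
proof -
  have "(\<Sum>k\<in>{n}. (e * x) ^ k /\<^sub>R fact k) \<le> (\<Sum>k. (e * x) ^ k /\<^sub>R fact k)"
    by (rule sum_le_suminf[OF summable_exp_generic]) (use assms in auto)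
  then have "(e * x) ^ n / fact n \<le> exp (e * x)"
    by (simp add: exp_def divide_inverse mult.commute)
  then have "x ^ n * e ^ n \<le> fact n * exp (e * x)"
    by (simp add: field_simps power_mult_distrib)
  then show ?thesis
    using assms by (simp add: exp_minus field_simps)
qed

text \<open>The bound forces \<open>f c = 0\<close> and makes the difference quotient at most
  \<open>K * \<bar>y - c\<bar>\<close>. It serves the two endpoints of a bump, where no formula
  holds on both sides.\<close>

lemma has_real_derivative_zero_quadratic:
  fixes f :: "real \<Rightarrow> real"
  assumes "\<And>y. \<bar>f y\<bar> \<le> K * (y - c)\<^sup>2"
  shows "(f has_real_derivative 0) (at c)"
proof -
  have "f c = 0" using assms[of c] by simp
  have "((\<lambda>y. (f y - f c) / (y - c)) \<longlongrightarrow> 0) (at c)"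
  proof (rule Lim_null_comparison)
    show "\<forall>\<^sub>F y in at c. norm ((f y - f c) / (y - c)) \<le> K * \<bar>y - c\<bar>"
      unfolding eventually_at_filter
    proof (intro always_eventually allI impI)
      fix y :: real assume "y \<noteq> c"
      moreover have "(y - c)\<^sup>2 = \<bar>y - c\<bar> * \<bar>y - c\<bar>" by (simp add: power2_eq_square)
      ultimately show "norm ((f y - f c) / (y - c)) \<le> K * \<bar>y - c\<bar>"
        using assms[of y] \<open>f c = 0\<close> by (simp add: divide_le_eq mult.assoc)
    qed
    show "((\<lambda>y. K * \<bar>y - c\<bar>) \<longlongrightarrow> 0) (at c)"
      by (auto intro!: tendsto_eq_intros)
  qed
  then show ?thesis by (simp add: has_field_derivative_iff)
qed

text \<open>This family is closed under differentiation, hence consists of smooth functions. Its members with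
  \<open>P = 1\<close>, \<open>k = 0\<close> tend to the indicator of \<open>(a, b)\<close> as \<open>e\<close> tends to 0, so no mollification is
  needed to see that a locally integrable function vanishing weakly is zero.\<close>

definition bump :: "real \<Rightarrow> real \<Rightarrow> real \<Rightarrow> real poly \<Rightarrow> nat \<Rightarrow> real \<Rightarrow> real" where
  "bump a b e P k x = (if a < x \<and> x < b
     then poly P x * (1 / ((x - a) * (b - x))) ^ k * exp (- (e * (1 / ((x - a) * (b - x))))) else 0)"

text \<open>With \<open>q = (x - a) * (b - x)\<close> and \<open>u = 1 / q\<close> one has
  \<open>u' = - q' * u^2\<close>. The three summands are those of the product rule for
  \<open>P * u^k * exp (- e * u)\<close>, each multiplied by the power of \<open>q\<close> that
  brings it to the common factor \<open>u^(k + 2)\<close>.\<close>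

definition bump_deriv :: "real \<Rightarrow> real \<Rightarrow> real \<Rightarrow> real poly \<Rightarrow> nat \<Rightarrow> real poly" where
  "bump_deriv a b e P k = (let q = [:- (a * b), a + b, - 1:] in
     pderiv P * q\<^sup>2 - smult (of_nat k) (P * pderiv q * q) + smult e (P * pderiv q))"

context
  fixes a b e :: real
  assumes ab: "a < b" and e: "e > 0"
begin

text \<open>The estimate \<open>power_times_exp_le\<close> is used with exponent
  \<open>k + 2\<close>: the two surplus powers of \<open>1/q\<close> turn into a factor
  \<open>q^2\<close>, which vanishes quadratically at both endpoints.\<close>

lemma bump_quadratic: "\<exists>K. \<forall>y. \<bar>bump a b e P k y\<bar> \<le> K * (y - a)\<^sup>2 \<and> \<bar>bump a b e P k y\<bar> \<le> K * (y - b)\<^sup>2"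
proof -
  have "compact (poly P ` {a..b})"
    by (intro compact_continuous_image continuous_intros) auto
  then obtain C where C: "\<And>y. y \<in> {a..b} \<Longrightarrow> \<bar>poly P y\<bar> \<le> C"
    by (auto dest!: compact_imp_bounded simp: bounded_iff) (metis atLeastAtMost_iff)
  define D where "D = fact (k + 2) / e ^ (k + 2)"
  have C0: "C \<ge> 0" using C[of a] ab by auto
  have D0: "D \<ge> 0" using e by (simp add: D_def)
  have main: "\<bar>bump a b e P k y\<bar> \<le> C * D * ((y - a) * (b - y))\<^sup>2" if "a < y" "y < b" for y
  proof -
    define q where "q = (y - a) * (b - y)"
    have q: "q > 0" using that by (simp add: q_def)
    have "(1/q) ^ (k + 2) * exp (- (e * (1/q))) \<le> D"
      unfolding D_def by (rule power_times_exp_le) (use q e in auto)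
    then have *: "(1/q) ^ k * exp (- (e * (1/q))) \<le> D * q\<^sup>2"
      using q by (simp add: field_simps power_add power2_eq_square)
    have "\<bar>bump a b e P k y\<bar> = \<bar>poly P y\<bar> * ((1/q) ^ k * exp (- (e * (1/q))))"
      using that q by (simp add: bump_def q_def abs_mult)
    also have "\<dots> \<le> C * (D * q\<^sup>2)"
      using that by (intro mult_mono C * C0) (use q in auto)
    finally show ?thesis by (simp add: q_def)
  qed
  define K where "K = C * D * (b - a)\<^sup>2"
  have K0: "K \<ge> 0" using C0 D0 by (simp add: K_def)
  have "\<bar>bump a b e P k y\<bar> \<le> K * (y - a)\<^sup>2 \<and> \<bar>bump a b e P k y\<bar> \<le> K * (y - b)\<^sup>2" for y
  proof (cases "a < y \<and> y < b")
    case True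
    then have "(b - y)\<^sup>2 \<le> (b - a)\<^sup>2" "(y - a)\<^sup>2 \<le> (b - a)\<^sup>2"
      by (auto intro!: power_mono)
    then have "((y - a) * (b - y))\<^sup>2 \<le> (b - a)\<^sup>2 * (y - a)\<^sup>2"
      "((y - a) * (b - y))\<^sup>2 \<le> (b - a)\<^sup>2 * (y - b)\<^sup>2"
      unfolding power_mult_distrib power2_commute[of y b]
      by (auto simp: mult.commute[of _ "(b - y)\<^sup>2"] intro!: mult_right_mono mult_left_mono)
    then have "C * D * ((y - a) * (b - y))\<^sup>2 \<le> K * (y - a)\<^sup>2"
      "C * D * ((y - a) * (b - y))\<^sup>2 \<le> K * (y - b)\<^sup>2"
      using C0 D0 by (auto simp: K_def mult.assoc intro!: mult_left_mono)
    then show ?thesis using main[of y] True by force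
  qed (use K0 in \<open>auto simp: bump_def\<close>)
  then show ?thesis by blast
qed

lemma bump_has_derivative:
  "(bump a b e P k has_real_derivative bump a b e (bump_deriv a b e P k) (k + 2) x) (at x)"
proof -
  obtain K where K: "\<And>y. \<bar>bump a b e P k y\<bar> \<le> K * (y - a)\<^sup>2" "\<And>y. \<bar>bump a b e P k y\<bar> \<le> K * (y - b)\<^sup>2"
    using bump_quadratic by blast
  consider "x \<in> {a<..<b}" | "x = a" | "x = b" | "x \<in> - {a..b}" by force
  then show ?thesis
  proof cases
    case 1
    define q where "q = (\<lambda>x. (x - a) * (b - x))"
    define u where "u = (\<lambda>x. 1 / q x)"
    have qx: "q x > 0" using 1 by (simp add: q_def)
    have poly_q: "poly [:- (a * b), a + b, - 1:] x = q x"
      by (simp add: q_def algebra_simps)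
    have dq: "poly (pderiv [:- (a * b), a + b, - 1:]) x = a + b - 2 * x"
      by (simp add: pderiv_pCons algebra_simps)
    have du: "(u has_real_derivative - (a + b - 2 * x) * u x ^ 2) (at x)"
    proof -
      have "(q has_real_derivative a + b - 2 * x) (at x)"
        unfolding q_def by (auto intro!: derivative_eq_intros simp: algebra_simps)
      from DERIV_inverse'[OF this]
      have "(u has_real_derivative - (u x * (a + b - 2 * x) * u x)) (at x)"
        using qx by (simp add: u_def inverse_eq_divide)
      then show ?thesis by (rule DERIV_cong) (simp add: power2_eq_square algebra_simps)
    qed
    have "((\<lambda>x. poly P x * u x ^ k * exp (- (e * u x))) has_real_derivative
        poly (bump_deriv a b e P k) x * u x ^ (k + 2) * exp (- (e * u x))) (at x)"
    proof -
      have "((\<lambda>x. poly P x * u x ^ k * exp (- (e * u x))) has_real_derivative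
        (poly (pderiv P) x * u x ^ k + poly P x * (of_nat k * u x ^ (k - 1) * (- (a + b - 2 * x) * u x ^ 2)))
           * exp (- (e * u x))
        + poly P x * u x ^ k * (exp (- (e * u x)) * (- (e * (- (a + b - 2 * x) * u x ^ 2))))) (at x)"
        by (rule derivative_eq_intros refl du)+ (simp add: mult_ac)
      \<comment> \<open>For \<open>k = 0\<close> the exponent \<open>k - 1\<close> is truncated to
        0, but the factor \<open>of_nat k\<close> makes both sides vanish.\<close>
      also have "of_nat k * u x ^ (k - 1) * (- (a + b - 2 * x) * u x ^ 2)
          = - of_nat k * (a + b - 2 * x) * u x ^ (k + 1)"
        by (cases k) (auto simp: power2_eq_square algebra_simps)
      also have "(poly (pderiv P) x * u x ^ k + poly P x * (- of_nat k * (a + b - 2 * x) * u x ^ (k + 1)))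
           * exp (- (e * u x))
        + poly P x * u x ^ k * (exp (- (e * u x)) * (- (e * (- (a + b - 2 * x) * u x ^ 2))))
        = poly (bump_deriv a b e P k) x * u x ^ (k + 2) * exp (- (e * u x))"
      proof -
        have uq: "u x ^ k = (q x)\<^sup>2 * u x ^ (k + 2)" "u x ^ (k + 1) = q x * u x ^ (k + 2)"
          using qx by (auto simp: u_def field_simps power2_eq_square power_add)
        show ?thesis
          unfolding bump_deriv_def Let_def poly_add poly_diff poly_mult poly_smult poly_power poly_q dq
          by (subst (1) uq(1), subst uq(2)) (simp add: algebra_simps power2_eq_square power_add)
      qed
      finally show ?thesis .
    qed
    then have "((\<lambda>x. poly P x * u x ^ k * exp (- (e * u x))) has_real_derivative
        bump a b e (bump_deriv a b e P k) (k + 2) x) (at x)"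
      using 1 by (simp add: bump_def u_def q_def)
    then show ?thesis
      by (rule has_field_derivative_transform_within_open[where S = "{a<..<b}"])
        (use 1 in \<open>auto simp: bump_def u_def q_def\<close>)
  next
    case 2
    moreover have "bump a b e (bump_deriv a b e P k) (k + 2) a = 0" by (simp add: bump_def)
    ultimately show ?thesis using has_real_derivative_zero_quadratic[OF K(1)] by simp
  next
    case 3
    moreover have "bump a b e (bump_deriv a b e P k) (k + 2) b = 0" by (simp add: bump_def)
    ultimately show ?thesis using has_real_derivative_zero_quadratic[OF K(2)] by simp
  next
    case 4
    have "((\<lambda>_. 0) has_real_derivative bump a b e (bump_deriv a b e P k) (k + 2) x) (at x)"
      using 4 by (auto simp: bump_def)
    then show ?thesis
      by (rule has_field_derivative_transform_within_open[where S = "- {a..b}"])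
        (use 4 in \<open>auto simp: bump_def\<close>)
  qed
qed

lemma test_function_bump: "test_function (bump a b e P k)"
proof -
  have "\<exists>Q j. (deriv ^^ n) (bump a b e P k) = bump a b e Q j" for n
  proof (induction n)
    case (Suc n)
    then obtain Q j where "(deriv ^^ n) (bump a b e P k) = bump a b e Q j" by blast
    then have "(deriv ^^ Suc n) (bump a b e P k) = bump a b e (bump_deriv a b e Q j) (j + 2)"
      using bump_has_derivative by (auto intro!: DERIV_imp_deriv)
    then show ?case by blast
  qed auto
  then have "(deriv ^^ n) (bump a b e P k) field_differentiable at x" for n x
    by (metis bump_has_derivative field_differentiable_def)
  moreover have "compact (closure {x. bump a b e P k x \<noteq> 0})"
    by (rule compact_closure[THEN iffD2], rule bounded_subset[of "{a..b}"])
      (auto simp: bump_def split: if_splits)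
  ultimately show ?thesis by (simp add: test_function_def)
qed

end

text \<open>At interior points the exponent tends to 0; elsewhere every member is 0. Using
  \<open>Suc n\<close> keeps the parameter positive, so each member is a test function when
  \<open>a < b\<close>.\<close>

lemma bump_tendsto_indicator:
  fixes a b :: real
  shows "(\<lambda>n. bump a b (1 / real (Suc n)) 1 0 x) \<longlonglongrightarrow> indicator {a<..<b} x"
proof (cases "a < x \<and> x < b")
  case True
  have "(\<lambda>n. exp (- (1 / real (Suc n) * (1 / ((x - a) * (b - x)))))) \<longlonglongrightarrow> exp (- (0 * (1 / ((x - a) * (b - x)))))"
    by (intro tendsto_intros LIMSEQ_Suc[OF lim_1_over_n])
  then show ?thesis using True by (simp add: bump_def)
qed (auto simp: bump_def)

lemma bump_one_bounds: "a < b \<Longrightarrow> e > 0 \<Longrightarrow> \<bar>bump a b e 1 0 x\<bar> \<le> indicator {a..b} x"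
  by (auto simp: bump_def indicator_def)

section \<open>The fundamental lemma of the calculus of variations\<close>

lemma borel_measurable_lebesgue_continuous:
  "continuous_on UNIV (f :: real \<Rightarrow> real) \<Longrightarrow> f \<in> borel_measurable lebesgue"
  by (intro measurable_completion) (simp add: borel_measurable_continuous_onI)

text \<open>Local integrability speaks only of restrictions to compact sets; \<open>g\<close> is the
  pointwise limit of its restrictions to growing intervals.\<close>

lemma loc_integrable_borel_measurable:
  assumes "loc_integrable g"
  shows "g \<in> borel_measurable lebesgue"
proof (rule borel_measurable_LIMSEQ_real)
  show "(\<lambda>n. indicator {- real n..real n} x * g x) \<longlonglongrightarrow> g x" for x
  proof (rule tendsto_eventually)
    show "\<forall>\<^sub>F n in sequentially. indicator {- real n..real n} x * g x = g x"
      using eventually_ge_at_top[of "nat \<lceil>\<bar>x\<bar>\<rceil>"]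
      by eventually_elim (auto simp: indicator_def abs_le_iff nat_le_iff ceiling_le_iff)
  qed
  show "(\<lambda>x. indicator {- real n..real n} x * g x) \<in> borel_measurable lebesgue" for n
    using assms by (auto simp: loc_integrable_def set_integrable_def intro: borel_measurable_integrable)
qed

text \<open>Dominated convergence along the bumps that tend to the indicator, with
  \<open>\<bar>g\<bar>\<close> on the closed interval as majorant.\<close>

lemma integral_interval_eq_0_if_weak_zero:
  assumes "loc_integrable g"
    and zero: "\<And>\<phi>. test_function \<phi> \<Longrightarrow> (LINT t|lebesgue. g t * \<phi> t) = 0"
    and "a < b"
  shows "(LINT t|lebesgue. g t * indicator {a<..<b} t) = 0"
proof -
  define \<phi> where "\<phi> = (\<lambda>n. bump a b (1 / real (Suc n)) 1 0)"
  have test: "test_function (\<phi> n)" for n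
    unfolding \<phi>_def by (rule test_function_bump) (use \<open>a < b\<close> in auto)
  have cont: "continuous_on UNIV (\<phi> n)" for n
    using test[of n] unfolding test_function_def
    by (metis continuous_at_imp_continuous_on field_differentiable_imp_continuous_at funpow_0)
  have [measurable]: "g \<in> borel_measurable lebesgue"
    using assms loc_integrable_borel_measurable by blast
  have [measurable]: "\<phi> n \<in> borel_measurable lebesgue" for n
    by (rule borel_measurable_lebesgue_continuous[OF cont])
  have "(\<lambda>n. LINT t|lebesgue. g t * \<phi> n t) \<longlonglongrightarrow> (LINT t|lebesgue. g t * indicator {a<..<b} t)"
  proof (rule integral_dominated_convergence)
    have "set_integrable lebesgue {a..b} g" using assms by (simp add: loc_integrable_def)
    then show "integrable lebesgue (\<lambda>t. \<bar>indicator {a..b} t * g t\<bar>)"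
      by (simp add: set_integrable_def)
    show "AE t in lebesgue. (\<lambda>n. g t * \<phi> n t) \<longlonglongrightarrow> g t * indicator {a<..<b} t"
      unfolding \<phi>_def by (intro AE_I2 tendsto_intros bump_tendsto_indicator)
    show "AE t in lebesgue. norm (g t * \<phi> n t) \<le> \<bar>indicator {a..b} t * g t\<bar>" for n
    proof (rule AE_I2)
      fix t
      have "\<bar>\<phi> n t\<bar> \<le> indicator {a..b} t"
        unfolding \<phi>_def by (rule bump_one_bounds) (use \<open>a < b\<close> in auto)
      then show "norm (g t * \<phi> n t) \<le> \<bar>indicator {a..b} t * g t\<bar>"
        by (auto simp: abs_mult mult.commute intro!: mult_left_mono)
    qed
  qed (auto intro!: borel_measurable_times borel_measurable_indicator)
  then show ?thesis
    using zero[OF test] by (simp add: LIMSEQ_const_iff)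
qed

text \<open>Since \<open>ennreal\<close> truncates negative numbers to 0,
  \<open>ennreal (f t)\<close> and \<open>ennreal (- f t)\<close> are the positive and negative
  parts of \<open>f\<close>. Taken as densities they give measures that agree on rays, hence
  everywhere; densities are unique, so the two parts coincide and both vanish.\<close>

lemma integrable_eq_0_AE_if_rays:
  fixes f :: "real \<Rightarrow> real"
  assumes int: "integrable lborel f"
    and zero: "\<And>x. (LINT t|lborel. f t * indicator {x<..} t) = 0"
  shows "AE t in lborel. f t = 0"
proof -
  have [measurable]: "f \<in> borel_measurable borel" using int by auto
  \<comment> \<open>Finiteness is what allows a return from real to extended integrals, because
    \<open>enn2real\<close> also sends infinity to 0; equality of measures from rays asks for it
    too.\<close>
  have fin: "(\<integral>\<^sup>+t. ennreal (f t) * indicator {x<..} t \<partial>lborel) < \<infinity>"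
    "(\<integral>\<^sup>+t. ennreal (- f t) * indicator {x<..} t \<partial>lborel) < \<infinity>" for x
  proof -
    have "(\<integral>\<^sup>+t. ennreal (norm (f t)) \<partial>lborel) < \<infinity>"
      using int by (simp add: integrable_iff_bounded)
    moreover have "(\<integral>\<^sup>+t. ennreal (f t) * indicator {x<..} t \<partial>lborel) \<le> (\<integral>\<^sup>+t. ennreal (norm (f t)) \<partial>lborel)"
      "(\<integral>\<^sup>+t. ennreal (- f t) * indicator {x<..} t \<partial>lborel) \<le> (\<integral>\<^sup>+t. ennreal (norm (f t)) \<partial>lborel)"
      by (auto intro!: nn_integral_mono ennreal_leI simp: indicator_def)
    ultimately show "(\<integral>\<^sup>+t. ennreal (f t) * indicator {x<..} t \<partial>lborel) < \<infinity>"
      "(\<integral>\<^sup>+t. ennreal (- f t) * indicator {x<..} t \<partial>lborel) < \<infinity>" by auto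
  qed
  have "density lborel (\<lambda>t. ennreal (f t)) = density lborel (\<lambda>t. ennreal (- f t))"
  proof (rule measure_eqI_lessThan)
    fix x
    have "integrable lborel (\<lambda>t. f t * indicator {x<..} t)"
      using integrable_mult_indicator[of "{x<..}" lborel f] int by (simp add: mult.commute)
    from real_lebesgue_integral_def[OF this] zero[of x]
    have "enn2real (\<integral>\<^sup>+t. ennreal (f t * indicator {x<..} t) \<partial>lborel)
        = enn2real (\<integral>\<^sup>+t. ennreal (- (f t * indicator {x<..} t)) \<partial>lborel)" by simp
    moreover have "ennreal (f t * indicator {x<..} t) = ennreal (f t) * indicator {x<..} t"
      "ennreal (- (f t * indicator {x<..} t)) = ennreal (- f t) * indicator {x<..} t" for t
      by (auto simp: indicator_def)
    ultimately have "(\<integral>\<^sup>+t. ennreal (f t) * indicator {x<..} t \<partial>lborel)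
        = (\<integral>\<^sup>+t. ennreal (- f t) * indicator {x<..} t \<partial>lborel)"
      using ennreal_enn2real[of "\<integral>\<^sup>+t. ennreal (f t) * indicator {x<..} t \<partial>lborel"]
        ennreal_enn2real[of "\<integral>\<^sup>+t. ennreal (- f t) * indicator {x<..} t \<partial>lborel"] fin[of x]
      by simp
    then show "emeasure (density lborel (\<lambda>t. ennreal (f t))) {x<..}
        = emeasure (density lborel (\<lambda>t. ennreal (- f t))) {x<..}"
      by (simp add: emeasure_density)
  qed (use fin in \<open>auto simp: emeasure_density\<close>)
  then have "AE t in lborel. ennreal (f t) = ennreal (- f t)"
    by (intro sigma_finite_measure.density_unique[OF sigma_finite_lborel]) auto
  then show ?thesis
    proof eventually_elim
    case (elim t)
    then show ?case
      by (cases "f t \<ge> 0") (auto simp: ennreal_neg dest: sym)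
  qed
qed

text \<open>On a window \<open>{- N<..<N}\<close> the function is integrable, and a ray meets the
  window in an open interval or not at all, so all its ray integrals vanish. Countably many windows
  cover the line.\<close>

theorem weak_zero_imp_AE_zero:
  assumes loc: "loc_integrable g"
    and zero: "\<And>\<phi>. test_function \<phi> \<Longrightarrow> (LINT t|lebesgue. g t * \<phi> t) = 0"
  shows "AE t in lebesgue. g t = 0"
proof -
  have "AE t in lebesgue. t \<in> {- real N<..<real N} \<longrightarrow> g t = 0" for N
  proof -
    define f where "f = (\<lambda>t. g t * indicator {- real N<..<real N} t)"
    have "set_integrable lebesgue {- real N<..<real N} g"
      by (rule set_integrable_subset[of _ "{- real N..real N}"]) (use loc in \<open>auto simp: loc_integrable_def\<close>)
    then have f: "integrable lebesgue f"
      by (simp add: f_def set_integrable_def mult.commute)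
    \<comment> \<open>The ray criterion is about \<open>lborel\<close>, so the Lebesgue measurable
      \<open>f\<close> is first replaced by a Borel version.\<close>
    obtain f' where f'm[measurable]: "f' \<in> borel_measurable lborel" and AE': "AE t in lborel. f t = f' t"
      using completion_ex_borel_measurable_real[of f lborel] f by auto
    have AE: "AE t in lebesgue. f t = f' t" using AE' by (rule AE_completion)
    have f': "integrable lebesgue f'"
      by (rule integrable_cong_AE_imp[OF f]) (use AE measurable_completion[OF f'm] in auto)
    have "AE t in lborel. f' t = 0"
    proof (rule integrable_eq_0_AE_if_rays)
      show "integrable lborel f'" using f' by (simp add: integrable_completion)
      fix x
      have "(LINT t|lborel. f' t * indicator {x<..} t) = (LINT t|lebesgue. f' t * indicator {x<..} t)"
        by (rule integral_completion[symmetric]) auto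
      also have "\<dots> = (LINT t|lebesgue. f t * indicator {x<..} t)"
        by (rule integral_cong_AE)
          (use f AE measurable_completion[OF f'm] in \<open>auto intro!: borel_measurable_times borel_measurable_indicator\<close>)
      also have "\<dots> = 0"
      proof (cases "max x (- real N) < real N")
        case True
        have "f t * indicator {x<..} t = g t * indicator {max x (- real N)<..<real N} t" for t
          by (auto simp: f_def indicator_def)
        then show ?thesis
          using integral_interval_eq_0_if_weak_zero[OF loc zero True] by simp
      next
        case False
        then have "(\<lambda>t. f t * indicator {x<..} t) = (\<lambda>t. 0)"
          by (auto simp: f_def indicator_def)
        then show ?thesis by (simp only: integral_zero)
      qed
      finally show "(LINT t|lborel. f' t * indicator {x<..} t) = 0" .
    qed
    then have "AE t in lebesgue. f' t = 0" by (rule AE_completion)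
    with AE show ?thesis by eventually_elim (auto simp: f_def)
  qed
  then have "AE t in lebesgue. \<forall>N. t \<in> {- real N<..<real N} \<longrightarrow> g t = 0"
    by (subst AE_all_countable) auto
  then show ?thesis
  proof eventually_elim
    case (elim t)
    obtain N :: nat where "\<bar>t\<bar> < real N" using reals_Archimedean2 by blast
    then show ?case using elim by (auto simp: abs_less_iff)
  qed
qed

section \<open>Locally absolutely continuous functions\<close>

lemma sigma_finite_lebesgue: "sigma_finite_measure (lebesgue :: real measure)"
proof
  obtain A :: "real set set" where "countable A" "A \<subseteq> sets lborel" "\<Union>A = space lborel"
      "\<forall>a\<in>A. emeasure lborel a \<noteq> \<infinity>"
    using sigma_finite_measure.sigma_finite_countable[OF sigma_finite_lborel] by blast
  then show "\<exists>A. countable A \<and> A \<subseteq> sets (lebesgue :: real measure) \<and> \<Union>A = space lebesgue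
      \<and> (\<forall>a\<in>A. emeasure lebesgue a \<noteq> \<infinity>)"
    by (intro exI[of _ A]) (auto simp: subset_iff)
qed

text \<open>The plane is cut along the diagonal into \<open>t \<le> x\<close> and
  \<open>x < t\<close>; each half of the double integral of \<open>f t * g x\<close> is evaluated by
  integrating the inner variable first. This is integration by parts for indefinite
  integrals.\<close>

lemma triangle_Fubini:
  fixes f g :: "real \<Rightarrow> real"
  assumes f: "integrable lebesgue f" and g: "integrable lebesgue g"
  shows "(LINT x|lebesgue. (LINT t|lebesgue. f t * indicator {..x} t) * g x)
      + (LINT t|lebesgue. f t * (LINT x|lebesgue. g x * indicator {..<t} x))
    = (LINT t|lebesgue. f t) * (LINT x|lebesgue. g x)"
proof -
  interpret L: sigma_finite_measure "lebesgue :: real measure" by (rule sigma_finite_lebesgue)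
  interpret P: pair_sigma_finite "lebesgue :: real measure" "lebesgue :: real measure" ..
  let ?P = "(lebesgue :: real measure) \<Otimes>\<^sub>M (lebesgue :: real measure)"
  have [measurable]: "f \<in> borel_measurable lebesgue" "g \<in> borel_measurable lebesgue"
    using f g by auto
  \<comment> \<open>Comparing \<open>fst\<close> and \<open>snd\<close> needs them Borel measurable
    on a product of completed measures; the identity from Lebesgue to Borel sets provides
    this.\<close>
  have id: "(\<lambda>x::real. x) \<in> borel_measurable lebesgue"
    by (intro measurable_completion) auto
  have [measurable]: "fst \<in> borel_measurable ?P" "snd \<in> borel_measurable ?P"
    using measurable_comp[OF measurable_fst id] measurable_comp[OF measurable_snd id]
    by (auto simp: comp_def)
  have H: "integrable ?P (\<lambda>(t, x). f t * g x)"
  proof (rule P.Fubini_integrable)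
    show "integrable lebesgue (\<lambda>x. LINT y|lebesgue. norm (case (x, y) of (t, x) \<Rightarrow> f t * g x))"
      using f g by (simp add: abs_mult)
  qed (use f g in auto)
  have S: "{p \<in> space ?P. fst p \<le> snd p} \<in> sets ?P" "{p \<in> space ?P. snd p < fst p} \<in> sets ?P"
    by measurable
  have h1: "integrable ?P (\<lambda>(t, x). f t * g x * indicator {..x} t)"
    using integrable_mult_indicator[OF S(1) H]
    by (rule Bochner_Integration.integrable_cong[OF refl, THEN iffD1, rotated])
      (auto simp: indicator_def space_pair_measure)
  have h2: "integrable ?P (\<lambda>(t, x). f t * g x * indicator {..<t} x)"
    using integrable_mult_indicator[OF S(2) H]
    by (rule Bochner_Integration.integrable_cong[OF refl, THEN iffD1, rotated])
      (auto simp: indicator_def space_pair_measure)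
  have "(LINT x|lebesgue. (LINT t|lebesgue. f t * indicator {..x} t) * g x)
      = (LINT x|lebesgue. LINT t|lebesgue. f t * g x * indicator {..x} t)"
    by (intro Bochner_Integration.integral_cong refl) (subst integral_mult_left_zero[symmetric], simp add: mult_ac)
  also have "\<dots> = integral\<^sup>L ?P (\<lambda>(t, x). f t * g x * indicator {..x} t)"
    by (rule P.integral_snd[OF h1])
  finally have 1: "(LINT x|lebesgue. (LINT t|lebesgue. f t * indicator {..x} t) * g x)
      = integral\<^sup>L ?P (\<lambda>(t, x). f t * g x * indicator {..x} t)" .
  have "(LINT t|lebesgue. f t * (LINT x|lebesgue. g x * indicator {..<t} x))
      = (LINT t|lebesgue. LINT x|lebesgue. f t * g x * indicator {..<t} x)"
    by (intro Bochner_Integration.integral_cong refl) (subst integral_mult_right_zero[symmetric], simp add: mult_ac)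
  also have "\<dots> = integral\<^sup>L ?P (\<lambda>(t, x). f t * g x * indicator {..<t} x)"
    by (rule P.integral_fst[OF h2])
  finally have 2: "(LINT t|lebesgue. f t * (LINT x|lebesgue. g x * indicator {..<t} x))
      = integral\<^sup>L ?P (\<lambda>(t, x). f t * g x * indicator {..<t} x)" .
  have "integral\<^sup>L ?P (\<lambda>(t, x). f t * g x * indicator {..x} t)
      + integral\<^sup>L ?P (\<lambda>(t, x). f t * g x * indicator {..<t} x)
      = integral\<^sup>L ?P (\<lambda>(t, x). f t * g x)"
    unfolding Bochner_Integration.integral_add[OF h1 h2, symmetric]
    by (intro Bochner_Integration.integral_cong refl) (auto simp: indicator_def)
  also have "\<dots> = (LINT t|lebesgue. LINT x|lebesgue. f t * g x)"
    by (rule P.integral_fst[OF H, symmetric])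
  also have "\<dots> = (LINT t|lebesgue. f t) * (LINT x|lebesgue. g x)"
    by simp
  finally show ?thesis using 1 2 by simp
qed

text \<open>Local absolute continuity of \<open>F\<close> with derivative \<open>f\<close>, encoded
  through the fundamental theorem of calculus. Integrability is a conjunct of its own because the
  integral of a non-integrable function defaults to 0.\<close>

definition primitive :: "(real \<Rightarrow> real) \<Rightarrow> (real \<Rightarrow> real) \<Rightarrow> bool" where
  "primitive F f \<longleftrightarrow> (\<forall>x y. x \<le> y \<longrightarrow>
     set_integrable lebesgue {x..y} f \<and> (LINT t:{x..y}|lebesgue. f t) = F y - F x)"

lemma primitiveD:
  assumes "primitive F f" "x \<le> y"
  shows "set_integrable lebesgue {x..y} f" "(LINT t:{x..y}|lebesgue. f t) = F y - F x"
    "(f has_integral (F y - F x)) {x..y}"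
  using assms has_integral_set_lebesgue[of "{x..y}" f] by (auto simp: primitive_def)

lemma primitive_continuous:
  assumes "primitive F f"
  shows "continuous_on UNIV F"
proof (rule continuous_at_imp_continuous_on, rule ballI)
  fix x
  have "continuous_on {x - 1..x + 1} (\<lambda>y. F (x - 1) + integral {x - 1..y} f)"
    by (intro continuous_intros indefinite_integral_continuous_1)
      (use primitiveD(3)[OF assms, of "x - 1" "x + 1"] in auto)
  then have "continuous_on {x - 1..x + 1} F"
  proof (rule continuous_on_eq)
    show "F (x - 1) + integral {x - 1..y} f = F y" if "y \<in> {x - 1..x + 1}" for y
      using primitiveD(3)[OF assms, of "x - 1" y] that by (auto simp: integral_unique)
  qed
  then show "isCont F x"
    by (rule continuous_on_interior) auto
qed

lemma loc_integrable_if_intervals: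
  assumes "\<And>x y. x \<le> y \<Longrightarrow> set_integrable lebesgue {x..y} f"
  shows "loc_integrable f"
  unfolding loc_integrable_def
proof (intro allI impI)
  fix K :: "real set" assume K: "compact K"
  then obtain c where c: "\<forall>x\<in>K. \<bar>x\<bar> \<le> c"
    by (auto dest!: compact_imp_bounded simp: bounded_iff)
  have "set_integrable lebesgue {-\<bar>c\<bar>..\<bar>c\<bar>} f" by (rule assms) auto
  then show "set_integrable lebesgue K f"
    by (rule set_integrable_subset) (use K c in \<open>force simp: compact_imp_closed borel_closed abs_le_iff\<close>)+
qed

lemma primitive_loc_integrable: "primitive F f \<Longrightarrow> loc_integrable f"
  by (intro loc_integrable_if_intervals primitiveD(1))

lemma continuous_loc_integrable: "continuous_on UNIV f \<Longrightarrow> loc_integrable f"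
  by (intro loc_integrable_if_intervals absolutely_integrable_continuous_real)
    (rule continuous_on_subset, auto)

lemma primitive_if_has_derivative:
  assumes "\<And>x. (F has_real_derivative f x) (at x)" "continuous_on UNIV f"
  shows "primitive F f"
  unfolding primitive_def
proof (intro allI impI conjI)
  fix x y :: real assume "x \<le> y"
  have "(f has_integral (F y - F x)) {x..y}"
    by (rule fundamental_theorem_of_calculus[OF \<open>x \<le> y\<close>])
      (metis assms(1) has_real_derivative_iff_has_vector_derivative has_vector_derivative_at_within)
  moreover show i: "set_integrable lebesgue {x..y} f"
    using continuous_loc_integrable[OF assms(2)] by (auto simp: loc_integrable_def)
  ultimately show "(LINT t:{x..y}|lebesgue. f t) = F y - F x"
    by (simp add: set_lebesgue_integral_eq_integral integral_unique)
qed

lemma primitive_exists: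
  assumes "loc_integrable f"
  obtains F where "primitive F f" "F 0 = 0"
proof
  \<comment> \<open>The signed integral from 0. Additivity is used for each position of 0 relative
    to \<open>x\<close> and \<open>y\<close>.\<close>
  define F where "F = (\<lambda>x. (if 0 \<le> x then integral {0..x} f else - integral {x..0} f))"
  have i: "set_integrable lebesgue {x..y} f" for x y
    using assms by (auto simp: loc_integrable_def)
  then have int: "f integrable_on {x..y}" for x y
    using set_lebesgue_integral_eq_integral(1) by blast
  show "primitive F f"
    unfolding primitive_def
  proof (intro allI impI conjI i)
    fix x y :: real assume "x \<le> y"
    then have "F y - F x = integral {x..y} f"
      using Henstock_Kurzweil_Integration.integral_combine[of 0 x y f]
        Henstock_Kurzweil_Integration.integral_combine[of x 0 y f]
        Henstock_Kurzweil_Integration.integral_combine[of x y 0 f] int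
      by (auto simp: F_def)
    then show "(LINT t:{x..y}|lebesgue. f t) = F y - F x"
      by (simp add: set_lebesgue_integral_eq_integral i)
  qed
  show "F 0 = 0" by (simp add: F_def)
qed

lemma primitive_has_derivative:
  assumes "primitive F f" "continuous_on UNIV f"
  shows "(F has_real_derivative f x) (at x)"
proof -
  have "((\<lambda>y. integral {x - 1..y} f) has_real_derivative f x) (at x within {x - 1..x + 1})"
    by (rule integral_has_real_derivative) (use assms(2) in \<open>auto intro: continuous_on_subset\<close>)
  then have "((\<lambda>y. integral {x - 1..y} f) has_real_derivative f x) (at x)"
    by (simp add: at_within_Icc_at)
  then have "((\<lambda>y. F (x - 1) + integral {x - 1..y} f) has_real_derivative f x) (at x)"
    by (auto intro!: derivative_eq_intros)
  then show ?thesis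
  proof (rule has_field_derivative_transform_within_open)
    show "F (x - 1) + integral {x - 1..y} f = F y" if "y \<in> {x - 1<..}" for y
      using primitiveD(3)[OF assms(1), of "x - 1" y] that by (auto simp: integral_unique)
  qed auto
qed

text \<open>The bound on \<open>f\<close> is asked only where \<open>g\<close> is non-zero, so
  \<open>g\<close> may carry the indicator of an interval on which a continuous \<open>f\<close> is
  bounded.\<close>

lemma integrable_mult_bounded:
  fixes f g :: "real \<Rightarrow> real"
  assumes "integrable lebesgue g" "f \<in> borel_measurable lebesgue" "\<And>t. g t \<noteq> 0 \<Longrightarrow> \<bar>f t\<bar> \<le> K"
  shows "integrable lebesgue (\<lambda>t. f t * g t)"
proof (rule Bochner_Integration.integrable_bound)
  show "integrable lebesgue (\<lambda>t. K * g t)" using assms by simp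
  show "AE t in lebesgue. norm (f t * g t) \<le> norm (K * g t)"
  proof (rule AE_I2)
    show "norm (f t * g t) \<le> norm (K * g t)" for t
      using assms(3)[of t] by (cases "g t = 0") (auto simp: abs_mult intro!: mult_right_mono)
  qed
qed (use assms in auto)

lemma set_integrable_mult_continuous:
  fixes f g :: "real \<Rightarrow> real"
  assumes "set_integrable lebesgue {x..y} g" "continuous_on UNIV f"
  shows "set_integrable lebesgue {x..y} (\<lambda>t. f t * g t)"
proof -
  have "compact (f ` {x..y})"
    by (rule compact_continuous_image) (use assms(2) continuous_on_subset in auto)
  then obtain K where K: "\<And>t. t \<in> {x..y} \<Longrightarrow> \<bar>f t\<bar> \<le> K"
    by (force dest!: compact_imp_bounded simp: bounded_iff)
  have "integrable lebesgue (\<lambda>t. f t * (indicator {x..y} t * g t))"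
    by (rule integrable_mult_bounded[where K=K])
      (use assms K in \<open>auto simp: set_integrable_def borel_measurable_lebesgue_continuous split: split_indicator_asm\<close>)
  then show ?thesis by (simp add: set_integrable_def mult_ac)
qed

text \<open>The triangle identity is applied to \<open>f\<close> and \<open>g\<close> cut off to
  \<open>{A..B}\<close>. For \<open>x\<close> in that interval the inner integrals are
  \<open>F x - F A\<close> and \<open>G x - G A\<close>; the constants \<open>F A\<close> and
  \<open>G A\<close> recombine with the product of the total integrals into the boundary
  term.\<close>

lemma primitive_mult:
  assumes F: "primitive F f" and G: "primitive G g"
  shows "primitive (\<lambda>t. F t * G t) (\<lambda>t. F t * g t + f t * G t)"
  unfolding primitive_def
proof (intro allI impI)
  fix A B :: real assume "A \<le> B"
  let ?f = "\<lambda>t. indicator {A..B} t * f t" and ?g = "\<lambda>t. indicator {A..B} t * g t"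
  have int: "set_integrable lebesgue {A..B} (\<lambda>t. F t * g t)" "set_integrable lebesgue {A..B} (\<lambda>t. G t * f t)"
    using set_integrable_mult_continuous[OF primitiveD(1)[OF G \<open>A \<le> B\<close>] primitive_continuous[OF F]]
      set_integrable_mult_continuous[OF primitiveD(1)[OF F \<open>A \<le> B\<close>] primitive_continuous[OF G]] by auto
  have f: "integrable lebesgue ?f" and g: "integrable lebesgue ?g"
    using primitiveD(1)[OF F \<open>A \<le> B\<close>] primitiveD(1)[OF G \<open>A \<le> B\<close>] by (auto simp: set_integrable_def)
  have 1: "(LINT t|lebesgue. ?f t * indicator {..x} t) = F x - F A" if "x \<in> {A..B}" for x
  proof -
    have "(LINT t|lebesgue. ?f t * indicator {..x} t) = (LINT t:{A..x}|lebesgue. f t)"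
      unfolding set_lebesgue_integral_def
      by (intro Bochner_Integration.integral_cong refl) (use that in \<open>auto simp: indicator_def\<close>)
    then show ?thesis using primitiveD(2)[OF F, of A x] that by simp
  qed
  \<comment> \<open>The inner ray is open here, so the point \<open>x\<close> is missing; it is a
    null set.\<close>
  have 2: "(LINT t|lebesgue. ?g t * indicator {..<x} t) = G x - G A" if "x \<in> {A..B}" for x
  proof -
    have "(LINT t|lebesgue. ?g t * indicator {..<x} t) = (LINT t:{A..x}|lebesgue. g t)"
      unfolding set_lebesgue_integral_def
    proof (rule integral_cong_AE)
      have "AE t in lborel. t \<noteq> x" by (rule AE_lborel_singleton)
      then have "AE t in lebesgue. t \<noteq> x" by (rule AE_completion)
      then show "AE t in lebesgue. ?g t * indicator {..<x} t = indicator {A..x} t *\<^sub>R g t"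
        by eventually_elim (use that in \<open>auto simp: indicator_def\<close>)
    qed (use loc_integrable_borel_measurable[OF primitive_loc_integrable[OF G]] in
        \<open>auto intro!: borel_measurable_times borel_measurable_indicator\<close>)
    then show ?thesis using primitiveD(2)[OF G, of A x] that by simp
  qed
  have tot: "(LINT t|lebesgue. ?f t) = F B - F A" "(LINT t|lebesgue. ?g t) = G B - G A"
    using primitiveD(2)[OF F \<open>A \<le> B\<close>] primitiveD(2)[OF G \<open>A \<le> B\<close>] by (auto simp: set_lebesgue_integral_def)
  have "(LINT x|lebesgue. (LINT t|lebesgue. ?f t * indicator {..x} t) * ?g x)
      = (LINT x|lebesgue. indicator {A..B} x * (F x * g x) - F A * ?g x)"
  proof (intro Bochner_Integration.integral_cong refl)
    show "(LINT t|lebesgue. ?f t * indicator {..x} t) * ?g x = indicator {A..B} x * (F x * g x) - F A * ?g x" for x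
    proof (cases "x \<in> {A..B}")
      case True
      then show ?thesis unfolding 1[OF True] by (simp add: algebra_simps)
    qed simp
  qed
  also have "\<dots> = (LINT x:{A..B}|lebesgue. F x * g x) - F A * (G B - G A)"
    using int g by (simp add: set_integrable_def set_lebesgue_integral_def tot)
  finally have I1: "(LINT x|lebesgue. (LINT t|lebesgue. ?f t * indicator {..x} t) * ?g x)
      = (LINT x:{A..B}|lebesgue. F x * g x) - F A * (G B - G A)" .
  have "(LINT t|lebesgue. ?f t * (LINT x|lebesgue. ?g x * indicator {..<t} x))
      = (LINT x|lebesgue. indicator {A..B} x * (G x * f x) - G A * ?f x)"
  proof (intro Bochner_Integration.integral_cong refl)
    show "?f x * (LINT t|lebesgue. ?g t * indicator {..<x} t) = indicator {A..B} x * (G x * f x) - G A * ?f x" for x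
    proof (cases "x \<in> {A..B}")
      case True
      then show ?thesis unfolding 2[OF True] by (simp add: algebra_simps)
    qed simp
  qed
  also have "\<dots> = (LINT x:{A..B}|lebesgue. G x * f x) - G A * (F B - F A)"
    using int f by (simp add: set_integrable_def set_lebesgue_integral_def tot)
  finally have I2: "(LINT t|lebesgue. ?f t * (LINT x|lebesgue. ?g x * indicator {..<t} x))
      = (LINT x:{A..B}|lebesgue. G x * f x) - G A * (F B - F A)" .
  have "(LINT x:{A..B}|lebesgue. F x * g x) + (LINT x:{A..B}|lebesgue. G x * f x) = F B * G B - F A * G A"
    using triangle_Fubini[OF f g] unfolding I1 I2 tot by (simp add: algebra_simps)
  moreover have eq: "(\<lambda>t. F t * g t + f t * G t) = (\<lambda>t. F t * g t + G t * f t)"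
    by (simp add: mult.commute)
  ultimately show "set_integrable lebesgue {A..B} (\<lambda>t. F t * g t + f t * G t) \<and>
      (LINT t:{A..B}|lebesgue. F t * g t + f t * G t) = F B * G B - F A * G A"
    using set_integral_add[OF int] unfolding eq by simp
qed

lemma primitive_lincomb:
  assumes F: "primitive F f" and G: "primitive G g"
  shows "primitive (\<lambda>t. F t + c * G t) (\<lambda>t. f t + c * g t)"
  unfolding primitive_def
proof (intro allI impI)
  fix x y :: real assume "x \<le> y"
  note f = primitiveD(1,2)[OF F \<open>x \<le> y\<close>] and g = primitiveD(1,2)[OF G \<open>x \<le> y\<close>]
  have cg: "set_integrable lebesgue {x..y} (\<lambda>t. c * g t)" using g(1) by simp
  show "set_integrable lebesgue {x..y} (\<lambda>t. f t + c * g t) \<and>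
      (LINT t:{x..y}|lebesgue. f t + c * g t) = (F y + c * G y) - (F x + c * G x)"
    using set_integral_add[OF f(1) cg] f(2) g(2) by (simp add: algebra_simps)
qed

lemma primitive_const: "primitive (\<lambda>_. c) (\<lambda>_. 0)"
  by (simp add: primitive_def)

section \<open>Weak derivatives\<close>

lemma test_function_has_derivative:
  assumes "test_function \<phi>"
  shows "(\<phi> has_real_derivative deriv \<phi> x) (at x)"
  using assms unfolding test_function_def
  by (metis DERIV_deriv_iff_field_differentiable funpow_0)

lemma test_function_continuous:
  assumes "test_function \<phi>"
  shows "continuous_on UNIV \<phi>" "continuous_on UNIV (deriv \<phi>)"
proof -
  show "continuous_on UNIV \<phi>"
    by (meson DERIV_isCont assms continuous_at_imp_continuous_on test_function_has_derivative)
  have "(deriv ^^ 1) \<phi> field_differentiable at x" for x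
    using assms unfolding test_function_def by blast
  then show "continuous_on UNIV (deriv \<phi>)"
    by (simp add: continuous_at_imp_continuous_on field_differentiable_imp_continuous_at)
qed

lemma test_function_support:
  assumes "test_function \<phi>"
  obtains R where "R > 0" "\<And>x. R \<le> \<bar>x\<bar> \<Longrightarrow> \<phi> x = 0" "\<And>x. R \<le> \<bar>x\<bar> \<Longrightarrow> deriv \<phi> x = 0"
proof -
  define S where "S = closure {x. \<phi> x \<noteq> 0}"
  have "bounded S" "closed S"
    using assms by (auto simp: S_def test_function_def compact_imp_bounded)
  then obtain R where R: "\<forall>x\<in>S. \<bar>x\<bar> \<le> R" by (auto simp: bounded_iff)
  \<comment> \<open>The margin 1 yields a positive radius and puts the points at exactly that
    distance outside \<open>S\<close>.\<close>
  have out: "x \<notin> S" if "\<bar>R\<bar> + 1 \<le> \<bar>x\<bar>" for x using R that by fastforce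
  have zero: "\<phi> x = 0" if "x \<notin> S" for x
    using that closure_subset[of "{x. \<phi> x \<noteq> 0}"] unfolding S_def by blast
  have deriv_zero: "deriv \<phi> x = 0" if "x \<notin> S" for x
  proof (rule DERIV_imp_deriv)
    show "(\<phi> has_real_derivative 0) (at x)"
    proof (rule has_field_derivative_transform_within_open)
      show "((\<lambda>_. 0) has_real_derivative 0) (at x)" by simp
      show "open (- S)" using \<open>closed S\<close> by (rule open_Compl)
      show "x \<in> - S" using that by simp
      show "0 = \<phi> y" if "y \<in> - S" for y using zero[of y] that by simp
    qed
  qed
  show ?thesis
    by (rule that[of "\<bar>R\<bar> + 1"]) (simp, (metis out zero), metis out deriv_zero)
qed

lemma test_functionI:
  assumes "\<And>n x. (deriv ^^ n) \<phi> field_differentiable at x" "\<And>x. R \<le> \<bar>x\<bar> \<Longrightarrow> \<phi> x = 0"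
  shows "test_function \<phi>"
proof -
  have "{x. \<phi> x \<noteq> 0} \<subseteq> {-R..R}" using assms(2) by (force simp: abs_le_iff)
  then have "bounded {x. \<phi> x \<noteq> 0}" by (rule bounded_subset[rotated]) auto
  then show ?thesis using assms(1) by (simp add: test_function_def compact_closure)
qed

lemma test_function_lincomb:
  assumes "test_function \<phi>" "test_function \<rho>"
  shows "test_function (\<lambda>x. \<phi> x + c * \<rho> x)"
proof -
  have d: "((deriv ^^ n) \<phi> has_real_derivative (deriv ^^ Suc n) \<phi> x) (at x)"
    "((deriv ^^ n) \<rho> has_real_derivative (deriv ^^ Suc n) \<rho> x) (at x)" for n x
    using assms by (simp_all add: DERIV_deriv_iff_field_differentiable test_function_def)
  have d': "((\<lambda>x. (deriv ^^ n) \<phi> x + c * (deriv ^^ n) \<rho> x) has_real_derivative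
      (deriv ^^ Suc n) \<phi> x + c * (deriv ^^ Suc n) \<rho> x) (at x)" for n x
    by (intro DERIV_add DERIV_cmult d)
  have eq: "(deriv ^^ n) (\<lambda>x. \<phi> x + c * \<rho> x) = (\<lambda>x. (deriv ^^ n) \<phi> x + c * (deriv ^^ n) \<rho> x)" for n
  proof (induction n)
    case (Suc n)
    then show ?case using d'[of n] by (auto intro!: DERIV_imp_deriv)
  qed simp
  obtain R where R: "\<And>x. R \<le> \<bar>x\<bar> \<Longrightarrow> \<phi> x = 0" using test_function_support[OF assms(1)] by metis
  obtain R' where R': "\<And>x. R' \<le> \<bar>x\<bar> \<Longrightarrow> \<rho> x = 0" using test_function_support[OF assms(2)] by metis
  show ?thesis
  proof (rule test_functionI[where R = "max R R'"])
    show "(deriv ^^ n) (\<lambda>x. \<phi> x + c * \<rho> x) field_differentiable at x" for n x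
      unfolding eq using d'[of n x] field_differentiable_def by blast
  qed (use R R' in auto)
qed

lemma test_function_antiderivative:
  assumes "test_function \<phi>" "\<And>x. (\<psi> has_real_derivative \<phi> x) (at x)" "\<And>x. R \<le> \<bar>x\<bar> \<Longrightarrow> \<psi> x = 0"
  shows "test_function \<psi>"
proof (rule test_functionI)
  have "deriv \<psi> = \<phi>" using assms(2) by (auto intro!: DERIV_imp_deriv)
  then show "(deriv ^^ n) \<psi> field_differentiable at x" for n x
  proof (cases n)
    case 0
    then show ?thesis using assms(2) by (auto simp: field_differentiable_def)
  next
    case (Suc k)
    then have "(deriv ^^ n) \<psi> = (deriv ^^ k) \<phi>"
      using \<open>deriv \<psi> = \<phi>\<close> by (simp add: funpow_swap1)
    then show ?thesis using assms(1) by (simp add: test_function_def)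
  qed
qed (rule assms(3))

lemma loc_integrable_lincomb:
  assumes "loc_integrable f" "loc_integrable g"
  shows "loc_integrable (\<lambda>t. f t + c * g t)"
  using assms unfolding loc_integrable_def
  by (intro allI impI set_integral_add(1) set_integrable_mult_right) auto

lemma interval_extend:
  fixes f :: "real \<Rightarrow> real"
  assumes "\<And>x. R \<le> \<bar>x\<bar> \<Longrightarrow> f x = 0"
  shows "indicator {-R..R} t *\<^sub>R f t = f t"
  using assms[of t] by (cases "R \<le> \<bar>t\<bar>") (auto simp: indicator_def)

lemma loc_integrable_mult_compact_support:
  assumes "loc_integrable w" "continuous_on UNIV \<phi>" "\<And>x. R \<le> \<bar>x\<bar> \<Longrightarrow> \<phi> x = 0"
  shows "integrable lebesgue (\<lambda>t. w t * \<phi> t)"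
proof -
  have "set_integrable lebesgue {-R..R} (\<lambda>t. \<phi> t * w t)"
    by (rule set_integrable_mult_continuous) (use assms in \<open>auto simp: loc_integrable_def\<close>)
  moreover have "(\<lambda>t. indicator {-R..R} t *\<^sub>R (\<phi> t * w t)) = (\<lambda>t. w t * \<phi> t)"
    using interval_extend[of R "\<lambda>t. \<phi> t * w t"] assms(3) by (auto simp: mult.commute)
  ultimately show ?thesis by (simp add: set_integrable_def)
qed

lemma loc_integrable_mult_test_function:
  assumes "loc_integrable w" "test_function \<phi>"
  shows "integrable lebesgue (\<lambda>t. w t * \<phi> t)" "integrable lebesgue (\<lambda>t. w t * deriv \<phi> t)"
proof -
  obtain R where "\<And>x. R \<le> \<bar>x\<bar> \<Longrightarrow> \<phi> x = 0" "\<And>x. R \<le> \<bar>x\<bar> \<Longrightarrow> deriv \<phi> x = 0"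
    using test_function_support[OF assms(2)] by metis
  then show "integrable lebesgue (\<lambda>t. w t * \<phi> t)" "integrable lebesgue (\<lambda>t. w t * deriv \<phi> t)"
    using loc_integrable_mult_compact_support assms(1) test_function_continuous[OF assms(2)] by blast+
qed

text \<open>The product rule for \<open>F * \<phi>\<close> on an interval containing the support of
  \<open>\<phi>\<close>; the boundary values are 0.\<close>

lemma has_weak_deriv_if_primitive:
  assumes F: "primitive F f"
  shows "has_weak_deriv F f"
  unfolding has_weak_deriv_def
proof (intro conjI allI impI)
  show locF: "loc_integrable F" by (rule continuous_loc_integrable[OF primitive_continuous[OF F]])
  show locf: "loc_integrable f" by (rule primitive_loc_integrable[OF F])
  fix \<phi> assume \<phi>: "test_function \<phi>"
  obtain R where R: "R > 0" "\<And>x. R \<le> \<bar>x\<bar> \<Longrightarrow> \<phi> x = 0" "\<And>x. R \<le> \<bar>x\<bar> \<Longrightarrow> deriv \<phi> x = 0"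
    using test_function_support[OF \<phi>] by metis
  have "primitive \<phi> (deriv \<phi>)"
    by (intro primitive_if_has_derivative test_function_has_derivative test_function_continuous \<phi>)
  from primitiveD(2)[OF primitive_mult[OF F this], of "-R" R]
  have "(LINT t:{-R..R}|lebesgue. F t * deriv \<phi> t + f t * \<phi> t) = 0"
    using R by simp
  moreover have "(\<lambda>t. indicator {-R..R} t *\<^sub>R (F t * deriv \<phi> t + f t * \<phi> t))
      = (\<lambda>t. F t * deriv \<phi> t + f t * \<phi> t)"
    by (intro ext interval_extend) (simp add: R)
  ultimately have "(LINT t|lebesgue. F t * deriv \<phi> t + f t * \<phi> t) = 0"
    by (simp add: set_lebesgue_integral_def)
  then show "(LINT t|lebesgue. F t * deriv \<phi> t) = - (LINT t|lebesgue. f t * \<phi> t)"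
    using loc_integrable_mult_test_function(1)[OF locf \<phi>] loc_integrable_mult_test_function(2)[OF locF \<phi>]
    by simp
qed

lemma not_AE_lebesgue_False: "\<not> (AE t in (lebesgue :: real measure). False)"
  by (simp add: AE_iff_null null_sets_def)

text \<open>Otherwise the constant 1 would vanish weakly, and by the fundamental lemma almost
  everywhere.\<close>

lemma test_function_integral_nonzero:
  obtains \<rho> where "test_function \<rho>" "(LINT t|lebesgue. \<rho> t) \<noteq> 0"
proof -
  have "\<exists>\<rho>. test_function \<rho> \<and> (LINT t|lebesgue. \<rho> t) \<noteq> 0"
  proof (rule ccontr)
    assume "\<not> ?thesis"
    then have "AE t::real in lebesgue. (\<lambda>_. 1::real) t = 0"
      using weak_zero_imp_AE_zero[of "\<lambda>_. 1"] continuous_loc_integrable[of "\<lambda>_. 1"] by simp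
    then show False using not_AE_lebesgue_False by simp
  qed
  then show ?thesis using that by blast
qed

text \<open>The antiderivative that vanishes at the left end of the support is constant to the right
  of it, with value the mean of \<open>\<theta>\<close>. Mean zero is thus what gives it compact
  support.\<close>

lemma test_function_zero_mean:
  assumes \<theta>: "test_function \<theta>" and mean: "(LINT t|lebesgue. \<theta> t) = 0"
  obtains \<psi> where "test_function \<psi>" "deriv \<psi> = \<theta>"
proof -
  obtain R where R: "R > 0" "\<And>x. R \<le> \<bar>x\<bar> \<Longrightarrow> \<theta> x = 0"
    using test_function_support[OF \<theta>] by metis
  have cont: "continuous_on UNIV \<theta>" by (rule test_function_continuous[OF \<theta>])
  then obtain P where P: "primitive P \<theta>" using primitive_exists continuous_loc_integrable by metis
  define \<psi> where "\<psi> = (\<lambda>x. P x - P (- R))"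
  have d: "(\<psi> has_real_derivative \<theta> x) (at x)" for x
    unfolding \<psi>_def using primitive_has_derivative[OF P cont, of x] by (auto intro!: derivative_eq_intros)
  have int0: "(LINT t:{x..y}|lebesgue. \<theta> t) = 0" if "\<And>t. t \<in> {x..y} \<Longrightarrow> R \<le> \<bar>t\<bar>" for x y
  proof -
    have "(\<lambda>t. indicator {x..y} t *\<^sub>R \<theta> t) = (\<lambda>_. 0)"
      using that R(2) by (auto simp: indicator_def)
    then show ?thesis by (simp only: set_lebesgue_integral_def integral_zero)
  qed
  have left: "\<psi> x = 0" if "x \<le> - R" for x
    using primitiveD(2)[OF P that] int0[of x "-R"] R(1) by (simp add: \<psi>_def)
  have "(\<lambda>t. indicator {-R..R} t *\<^sub>R \<theta> t) = \<theta>"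
    by (intro ext interval_extend R(2))
  then have "\<psi> R = 0"
    using primitiveD(2)[OF P, of "-R" R] R(1) mean by (simp add: \<psi>_def set_lebesgue_integral_def)
  then have right: "\<psi> x = 0" if "R \<le> x" for x
    using primitiveD(2)[OF P that] int0[of R x] R(1) by (simp add: \<psi>_def)
  have "test_function \<psi>"
    by (rule test_function_antiderivative[OF \<theta> d, of R]) (use left right in \<open>force simp: abs_if split: if_splits\<close>)
  moreover have "deriv \<psi> = \<theta>" using d by (auto intro!: DERIV_imp_deriv)
  ultimately show ?thesis using that by blast
qed

text \<open>The du Bois-Reymond lemma. The difference \<open>w\<close> of \<open>f\<close> and any
  primitive \<open>G\<close> of \<open>g\<close> annihilates all derivatives of test functions, that
  is, all test functions of mean zero. Subtracting a multiple of a fixed \<open>\<rho>\<close> gives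
  any test function mean zero, so \<open>w\<close> is constant almost everywhere.\<close>

theorem has_weak_deriv_imp_primitive:
  assumes fg: "has_weak_deriv f g"
  obtains F where "primitive F g" "AE t in lebesgue. f t = F t"
proof -
  have f: "loc_integrable f" and g: "loc_integrable g" using fg by (auto simp: has_weak_deriv_def)
  obtain G where G: "primitive G g" using primitive_exists[OF g] by blast
  have Gg: "has_weak_deriv G g" by (rule has_weak_deriv_if_primitive[OF G])
  then have "loc_integrable G" by (simp add: has_weak_deriv_def)
  define w where "w = (\<lambda>t. f t + (-1) * G t)"
  have w: "loc_integrable w" unfolding w_def by (rule loc_integrable_lincomb[OF f \<open>loc_integrable G\<close>])
  obtain \<rho> where \<rho>: "test_function \<rho>" "(LINT t|lebesgue. \<rho> t) \<noteq> 0"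
    using test_function_integral_nonzero by blast
  \<comment> \<open>The only possible constant: the value obtained by testing \<open>w = C\<close>
    against \<open>\<rho>\<close>.\<close>
  define C where "C = (LINT t|lebesgue. w t * \<rho> t) / (LINT t|lebesgue. \<rho> t)"
  have one: "loc_integrable (\<lambda>_. 1)" by (intro continuous_loc_integrable continuous_intros)
  have int: "integrable lebesgue \<phi>" if "test_function \<phi>" for \<phi>
    using loc_integrable_mult_test_function(1)[OF one that] by simp
  have w0: "(LINT t|lebesgue. w t * deriv \<psi> t) = 0" if "test_function \<psi>" for \<psi>
  proof -
    have "(LINT t|lebesgue. w t * deriv \<psi> t)
        = (LINT t|lebesgue. f t * deriv \<psi> t - G t * deriv \<psi> t)"
      by (simp add: w_def algebra_simps)
    also have "\<dots> = (LINT t|lebesgue. f t * deriv \<psi> t) - (LINT t|lebesgue. G t * deriv \<psi> t)"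
      by (intro Bochner_Integration.integral_diff loc_integrable_mult_test_function f \<open>loc_integrable G\<close> that)
    also have "\<dots> = 0"
      using fg Gg that by (simp add: has_weak_deriv_def)
    finally show ?thesis .
  qed
  have "AE t in lebesgue. w t + (- C) * 1 = 0"
  proof (rule weak_zero_imp_AE_zero[OF loc_integrable_lincomb[OF w one]])
    fix \<phi> assume \<phi>: "test_function \<phi>"
    \<comment> \<open>Chosen so that \<open>\<theta>\<close> has mean zero.\<close>
    define k where "k = (LINT t|lebesgue. \<phi> t) / (LINT t|lebesgue. \<rho> t)"
    define \<theta> where "\<theta> = (\<lambda>t. \<phi> t + (- k) * \<rho> t)"
    have \<theta>: "test_function \<theta>" unfolding \<theta>_def by (rule test_function_lincomb[OF \<phi> \<rho>(1)])
    have "(LINT t|lebesgue. \<theta> t) = (LINT t|lebesgue. \<phi> t) - k * (LINT t|lebesgue. \<rho> t)"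
      using int[OF \<phi>] int[OF \<rho>(1)] by (simp add: \<theta>_def)
    also have "\<dots> = 0" using \<rho>(2) by (simp add: k_def)
    finally obtain \<psi> where \<psi>: "test_function \<psi>" "deriv \<psi> = \<theta>"
      using test_function_zero_mean[OF \<theta>] by blast
    note i = loc_integrable_mult_test_function(1)[OF w \<phi>] loc_integrable_mult_test_function(1)[OF w \<rho>(1)]
    have "0 = (LINT t|lebesgue. w t * \<theta> t)" using w0[OF \<psi>(1)] \<psi>(2) by simp
    also have "\<dots> = (LINT t|lebesgue. w t * \<phi> t - k * (w t * \<rho> t))"
      by (simp add: \<theta>_def algebra_simps)
    also have "\<dots> = (LINT t|lebesgue. w t * \<phi> t) - k * (LINT t|lebesgue. w t * \<rho> t)"
      using i by simp
    also have "k * (LINT t|lebesgue. w t * \<rho> t) = C * (LINT t|lebesgue. \<phi> t)"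
      by (simp add: k_def C_def)
    finally have *: "(LINT t|lebesgue. w t * \<phi> t) - C * (LINT t|lebesgue. \<phi> t) = 0" by simp
    have "(LINT t|lebesgue. (w t + (- C) * 1) * \<phi> t) = (LINT t|lebesgue. w t * \<phi> t - C * \<phi> t)"
      by (simp add: algebra_simps)
    also have "\<dots> = 0" using i int[OF \<phi>] * by simp
    finally show "(LINT t|lebesgue. (w t + (- C) * 1) * \<phi> t) = 0" .
  qed
  then have "AE t in lebesgue. f t = G t + 1 * C"
    by eventually_elim (simp add: w_def)
  moreover have "primitive (\<lambda>t. G t + 1 * C) (\<lambda>t. g t + 1 * 0)"
    by (rule primitive_lincomb[OF G primitive_const])
  ultimately show ?thesis using that by simp
qed

section \<open>Weak derivatives up to null sets\<close>

lemma has_weak_deriv_unique: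
  assumes "has_weak_deriv f g" "has_weak_deriv f h"
  shows "AE t in lebesgue. g t = h t"
proof -
  have l: "loc_integrable g" "loc_integrable h" using assms by (auto simp: has_weak_deriv_def)
  have "AE t in lebesgue. g t + (-1) * h t = 0"
  proof (rule weak_zero_imp_AE_zero[OF loc_integrable_lincomb[OF l]])
    fix \<phi> assume \<phi>: "test_function \<phi>"
    have "(LINT t|lebesgue. (g t + (-1) * h t) * \<phi> t) = (LINT t|lebesgue. g t * \<phi> t - h t * \<phi> t)"
      by (simp add: algebra_simps)
    also have "\<dots> = (LINT t|lebesgue. g t * \<phi> t) - (LINT t|lebesgue. h t * \<phi> t)"
      by (intro Bochner_Integration.integral_diff loc_integrable_mult_test_function l \<phi>)
    also have "\<dots> = 0" using assms \<phi> by (simp add: has_weak_deriv_def)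
    finally show "(LINT t|lebesgue. (g t + (-1) * h t) * \<phi> t) = 0" .
  qed
  then show ?thesis by eventually_elim simp
qed

lemma loc_integrable_cong_AE:
  assumes "loc_integrable f" "AE t in lebesgue. f t = g t"
  shows "loc_integrable g"
  unfolding loc_integrable_def
proof (intro allI impI)
  fix K :: "real set" assume K: "compact K"
  have m: "g \<in> borel_measurable lebesgue"
    using assms borel_measurable_AE loc_integrable_borel_measurable by blast
  have "integrable lebesgue (\<lambda>t. indicator K t * g t)"
  proof (rule integrable_cong_AE_imp)
    show "integrable lebesgue (\<lambda>t. indicator K t * f t)"
      using assms(1) K by (simp add: loc_integrable_def set_integrable_def)
    show "(\<lambda>t. indicator K t * g t) \<in> borel_measurable lebesgue"
      using K m by (auto intro!: borel_measurable_times borel_measurable_indicator simp: compact_imp_closed borel_closed)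
    show "AE t in lebesgue. indicator K t * f t = indicator K t * g t"
      using assms(2) by eventually_elim simp
  qed
  then show "set_integrable lebesgue K g" by (simp add: set_integrable_def)
qed

lemma has_weak_deriv_cong_AE:
  assumes fg: "has_weak_deriv f g" and f: "AE t in lebesgue. f t = f' t" and g: "AE t in lebesgue. g t = g' t"
  shows "has_weak_deriv f' g'"
  unfolding has_weak_deriv_def
proof (intro conjI allI impI)
  have l: "loc_integrable f" "loc_integrable g" using fg by (auto simp: has_weak_deriv_def)
  show l': "loc_integrable f'" "loc_integrable g'"
    using loc_integrable_cong_AE l f g by blast+
  fix \<phi> assume \<phi>: "test_function \<phi>"
  have "(LINT t|lebesgue. f' t * deriv \<phi> t) = (LINT t|lebesgue. f t * deriv \<phi> t)"
    by (rule integral_cong_AE)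
      (use loc_integrable_mult_test_function(2)[OF _ \<phi>] l l' f in auto)
  moreover have "(LINT t|lebesgue. g' t * \<phi> t) = (LINT t|lebesgue. g t * \<phi> t)"
    by (rule integral_cong_AE)
      (use loc_integrable_mult_test_function(1)[OF _ \<phi>] l l' g in auto)
  ultimately show "(LINT t|lebesgue. f' t * deriv \<phi> t) = - (LINT t|lebesgue. g' t * \<phi> t)"
    using fg \<phi> by (simp add: has_weak_deriv_def)
qed

lemma has_weak_deriv_weak_deriv: "has_weak_deriv f g \<Longrightarrow> has_weak_deriv f (weak_deriv f)"
  unfolding weak_deriv_def by (rule someI[of "has_weak_deriv f"])

lemma weak_deriv_AE_eq: "has_weak_deriv f g \<Longrightarrow> AE t in lebesgue. weak_deriv f t = g t"
  by (rule has_weak_deriv_unique[OF has_weak_deriv_weak_deriv])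

text \<open>With a non-zero limit, \<open>\<bar>K\<bar>\<close> stays above
  \<open>\<bar>J\<bar> / 2\<close> on a half-line, and intervals of length \<open>n\<close> inside
  it make the integral exceed any bound.\<close>

lemma integrable_tendsto_at_top_0:
  fixes K :: "real \<Rightarrow> real"
  assumes int: "integrable lebesgue K" and lim: "(K \<longlongrightarrow> J) at_top"
  shows "J = 0"
proof (rule ccontr)
  assume "J \<noteq> 0"
  define c where "c = \<bar>J\<bar> / 2"
  have c: "c > 0" using \<open>J \<noteq> 0\<close> by (simp add: c_def)
  have "\<forall>\<^sub>F x in at_top. dist (K x) J < c" using lim c by (rule tendstoD)
  then obtain N where N: "\<And>x. x \<ge> N \<Longrightarrow> c \<le> \<bar>K x\<bar>"
    unfolding eventually_at_top_linorder dist_real_def c_def by (smt (verit) field_sum_of_halves)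
  have "real n * c \<le> (LINT x|lebesgue. \<bar>K x\<bar>)" for n :: nat
  proof -
    have "real n * c = (LINT x|lebesgue. indicator {N..N + real n} x * c)"
      by simp
    also have "\<dots> \<le> (LINT x|lebesgue. \<bar>K x\<bar>)"
    proof (rule integral_mono)
      show "indicator {N..N + real n} x * c \<le> \<bar>K x\<bar>" for x
        using N[of x] by (auto simp: indicator_def)
    qed (use int in auto)
    finally show ?thesis .
  qed
  moreover obtain n :: nat where "(LINT x|lebesgue. \<bar>K x\<bar>) < real n * c"
    using reals_Archimedean3[OF c] by blast
  ultimately show False using not_le by blast
qed

text \<open>The integral of \<open>f\<close> over \<open>{-x..x}\<close> is
  \<open>F x - F (- x)\<close>. It converges as \<open>x\<close> grows, and as a function of
  \<open>x\<close> it is itself integrable, so its limit is 0. This is the integration by parts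
  without boundary terms.\<close>

lemma integral_primitive_eq_0:
  assumes P: "primitive F f" and F: "integrable lebesgue F" and f: "integrable lebesgue f"
  shows "(LINT t|lebesgue. f t) = 0"
proof -
  have [measurable]: "f \<in> borel_measurable lebesgue" using f by auto
  have mF: "F \<in> borel_measurable borel"
    by (rule borel_measurable_continuous_onI[OF primitive_continuous[OF P]])
  \<comment> \<open>The reflection is carried out in \<open>lborel\<close>, which is possible since
    \<open>F\<close> is continuous and so Borel.\<close>
  have "integrable lborel F" using F mF by (simp add: integrable_completion)
  then have "integrable lborel (\<lambda>x. F (0 + (-1) * x))"
    by (rule lborel_integrable_real_affine) simp
  then have "integrable lebesgue (\<lambda>x. F (- x))"
    using mF by (simp add: integrable_completion)
  then have K: "integrable lebesgue (\<lambda>x. F x - F (- x))" using F by simp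
  have "((\<lambda>x. LINT t|lebesgue. indicator {-x..x} t * f t) \<longlongrightarrow> (LINT t|lebesgue. f t)) at_top"
  proof (rule integral_dominated_convergence_at_top)
    show "integrable lebesgue (\<lambda>t. \<bar>f t\<bar>)" using f by simp
    show "\<forall>\<^sub>F x in at_top. AE t in lebesgue. norm (indicator {-x..x} t * f t) \<le> \<bar>f t\<bar>"
      by (auto simp: indicator_def)
    show "AE t in lebesgue. ((\<lambda>x. indicator {-x..x} t * f t) \<longlongrightarrow> f t) at_top"
    proof (rule AE_I2)
      fix t
      have "\<forall>\<^sub>F x in at_top. indicator {-x..x} t * f t = f t"
        using eventually_ge_at_top[of "\<bar>t\<bar>"] by eventually_elim (auto simp: indicator_def)
      then show "((\<lambda>x. indicator {-x..x} t * f t) \<longlongrightarrow> f t) at_top" by (rule tendsto_eventually)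
    qed
  qed (auto intro!: borel_measurable_times borel_measurable_indicator)
  moreover have "\<forall>\<^sub>F x in at_top. (LINT t|lebesgue. indicator {-x..x} t * f t) = F x - F (- x)"
    using eventually_ge_at_top[of 0]
    by eventually_elim (use primitiveD(2)[OF P] in \<open>simp add: set_lebesgue_integral_def\<close>)
  ultimately have "((\<lambda>x. F x - F (- x)) \<longlongrightarrow> (LINT t|lebesgue. f t)) at_top"
    by (rule Lim_transform_eventually)
  then show ?thesis by (rule integrable_tendsto_at_top_0[OF K])
qed

lemma primitive_bounded:
  assumes P: "primitive F f" and f: "integrable lebesgue f"
  obtains B where "\<And>x. \<bar>F x\<bar> \<le> B"
proof -
  have *: "\<bar>F y - F x\<bar> \<le> (LINT t|lebesgue. \<bar>f t\<bar>)" if "x \<le> y" for x y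
  proof -
    have "\<bar>F y - F x\<bar> = \<bar>LINT t|lebesgue. indicator {x..y} t * f t\<bar>"
      using primitiveD(2)[OF P that] by (simp add: set_lebesgue_integral_def)
    also have "\<dots> \<le> (LINT t|lebesgue. \<bar>indicator {x..y} t * f t\<bar>)" by (rule integral_abs_bound)
    also have "\<dots> \<le> (LINT t|lebesgue. \<bar>f t\<bar>)"
    proof (rule integral_mono)
      show "integrable lebesgue (\<lambda>t. \<bar>indicator {x..y} t * f t\<bar>)"
        using primitiveD(1)[OF P that] by (intro integrable_abs) (simp add: set_integrable_def)
    qed (use f in \<open>auto simp: indicator_def\<close>)
    finally show ?thesis .
  qed
  have "\<bar>F x\<bar> \<le> \<bar>F 0\<bar> + (LINT t|lebesgue. \<bar>f t\<bar>)" for x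
    using *[of 0 x] *[of x 0] by (cases "0 \<le> x") auto
  then show ?thesis using that by blast
qed

section \<open>Square-integrable functions\<close>

text \<open>Second order rather than third: the error has to be a multiple of the squared phase, so
  that \<open>\<bar>p\<bar> * E^2\<close> arises and Cauchy-Schwarz yields the squared L^4 norm in
  \<open>M_const\<close>.\<close>

lemma sin_minus_self_bound: "\<bar>sin x - x\<bar> \<le> x\<^sup>2 / 2" for x :: real
  using Maclaurin_sin_bound[of x 2] by (simp add: numeral_2_eq_2 sin_coeff_def power2_eq_square)

lemma one_minus_cos_double_bound: "1 - cos (2 * x) \<le> 2 * x\<^sup>2" for x :: real
proof -
  have "(sin x)\<^sup>2 \<le> x\<^sup>2" using abs_sin_x_le_abs_x[of x] by (simp flip: abs_le_square_iff)
  then show ?thesis by (simp add: cos_double_sin)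
qed

lemma square_integrableD:
  "square_integrable f \<Longrightarrow> f \<in> borel_measurable lebesgue"
  "square_integrable f \<Longrightarrow> integrable lebesgue (\<lambda>t. (f t)\<^sup>2)"
  by (auto simp: square_integrable_def)

lemma square_integrable_imp_loc:
  assumes "square_integrable f"
  shows "loc_square_integrable f"
  unfolding loc_square_integrable_def set_integrable_def
  by (intro conjI allI impI integrable_mult_indicator square_integrableD assms)
    (simp add: compact_imp_closed borel_closed)

lemma square_integrable_bound:
  assumes "square_integrable g" "f \<in> borel_measurable lebesgue" "\<And>t. \<bar>f t\<bar> \<le> K * \<bar>g t\<bar>"
  shows "square_integrable f"
proof -
  have le: "(f t)\<^sup>2 \<le> K\<^sup>2 * (g t)\<^sup>2" for t
  proof -
    have "\<bar>f t\<bar>\<^sup>2 \<le> (K * \<bar>g t\<bar>)\<^sup>2" using assms(3)[of t] by (intro power_mono) auto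
    then show ?thesis by (simp add: power_mult_distrib)
  qed
  have "integrable lebesgue (\<lambda>t. (f t)\<^sup>2)"
  proof (rule Bochner_Integration.integrable_bound)
    show "integrable lebesgue (\<lambda>t. K\<^sup>2 * (g t)\<^sup>2)" using assms(1) by (simp add: square_integrable_def)
    show "AE t in lebesgue. norm ((f t)\<^sup>2) \<le> norm (K\<^sup>2 * (g t)\<^sup>2)" using le by (simp add: abs_mult)
  qed (use assms(2) in auto)
  then show ?thesis using assms(2) by (simp add: square_integrable_def)
qed

lemma square_integrable_mult_bounded:
  assumes "square_integrable g" "f \<in> borel_measurable lebesgue" "\<And>t. \<bar>f t\<bar> \<le> K"
  shows "square_integrable (\<lambda>t. f t * g t)"
  by (rule square_integrable_bound[OF assms(1), where K=K])
    (use assms square_integrableD in \<open>auto simp: abs_mult intro!: mult_right_mono\<close>)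

lemma integrable_mult_square_integrable:
  assumes "square_integrable f" "square_integrable g"
  shows "integrable lebesgue (\<lambda>t. f t * g t)"
proof (rule Bochner_Integration.integrable_bound[of lebesgue "\<lambda>t. (f t)\<^sup>2 + (g t)\<^sup>2"])
  show "AE t in lebesgue. norm (f t * g t) \<le> norm ((f t)\<^sup>2 + (g t)\<^sup>2)"
  proof (rule AE_I2)
    fix t
    have "0 \<le> (\<bar>f t\<bar> - \<bar>g t\<bar>)\<^sup>2" by simp
    then have "2 * (\<bar>f t\<bar> * \<bar>g t\<bar>) \<le> (f t)\<^sup>2 + (g t)\<^sup>2"
      by (simp add: power2_diff)
    moreover have "0 \<le> \<bar>f t\<bar> * \<bar>g t\<bar>" by simp
    ultimately have "\<bar>f t\<bar> * \<bar>g t\<bar> \<le> (f t)\<^sup>2 + (g t)\<^sup>2" by linarith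
    then show "norm (f t * g t) \<le> norm ((f t)\<^sup>2 + (g t)\<^sup>2)" by (simp add: abs_mult)
  qed
qed (use assms in \<open>auto simp: square_integrable_def\<close>)

lemma square_integrable_add:
  assumes "square_integrable f" "square_integrable g"
  shows "square_integrable (\<lambda>t. f t + g t)"
proof -
  have "integrable lebesgue (\<lambda>t. (f t)\<^sup>2 + (g t)\<^sup>2 + 2 * (f t * g t))"
    using assms integrable_mult_square_integrable[OF assms] by (simp add: square_integrable_def)
  then show ?thesis
    using assms by (auto simp: square_integrable_def power2_sum mult.assoc)
qed

lemma square_integrable_cmult:
  assumes "square_integrable f"
  shows "square_integrable (\<lambda>t. c * f t)"
  by (rule square_integrable_mult_bounded[OF assms, of _ "\<bar>c\<bar>"]) auto

lemma square_integrable_cong_AE: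
  assumes "square_integrable f" "AE t in lebesgue. f t = g t"
  shows "square_integrable g"
proof -
  have [measurable]: "g \<in> borel_measurable lebesgue"
    using assms borel_measurable_AE square_integrableD(1) by blast
  have "integrable lebesgue (\<lambda>t. (g t)\<^sup>2)"
  proof (rule integrable_cong_AE_imp)
    show "AE t in lebesgue. (f t)\<^sup>2 = (g t)\<^sup>2" using assms(2) by eventually_elim simp
  qed (use assms in \<open>auto simp: square_integrable_def\<close>)
  then show ?thesis by (simp add: square_integrable_def)
qed

text \<open>The discriminant argument: the integral of \<open>(l * u - v)^2\<close> is a
  non-negative quadratic in \<open>l\<close>, evaluated at its minimiser
  \<open>Z / X\<close>.\<close>

lemma Cauchy_Schwarz_integral:
  assumes "square_integrable u" "square_integrable v"
  shows "(LINT t|lebesgue. u t * v t) \<le> sqrt (LINT t|lebesgue. (u t)\<^sup>2) * sqrt (LINT t|lebesgue. (v t)\<^sup>2)"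
proof -
  define X Y Z where "X = (LINT t|lebesgue. (u t)\<^sup>2)" and "Y = (LINT t|lebesgue. (v t)\<^sup>2)"
    and "Z = (LINT t|lebesgue. u t * v t)"
  have XY: "X \<ge> 0" "Y \<ge> 0" by (auto simp: X_def Y_def)
  note i = square_integrableD(2)[OF assms(1)] square_integrableD(2)[OF assms(2)]
    integrable_mult_square_integrable[OF assms]
  have q: "l\<^sup>2 * X - 2 * l * Z + Y \<ge> 0" for l
  proof -
    have "l\<^sup>2 * X - 2 * l * Z + Y = (LINT t|lebesgue. l\<^sup>2 * (u t)\<^sup>2 - 2 * l * (u t * v t) + (v t)\<^sup>2)"
      using i by (simp add: X_def Y_def Z_def)
    also have "\<dots> = (LINT t|lebesgue. (l * u t - v t)\<^sup>2)"
      by (simp add: power2_eq_square algebra_simps)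
    also have "\<dots> \<ge> 0" by simp
    finally show ?thesis .
  qed
  have "Z\<^sup>2 \<le> X * Y"
  proof (cases "X = 0")
    case True
    have "Z = 0"
    proof (rule ccontr)
      assume "Z \<noteq> 0"
      \<comment> \<open>For \<open>X = 0\<close> the quadratic degenerates to
        \<open>Y - 2 * l * Z\<close>, and this \<open>l\<close> would give it the value -1.\<close>
      then have "2 * ((Y + 1) / (2 * Z)) * Z = Y + 1" by simp
      then show False using q[of "(Y + 1) / (2 * Z)"] True by simp
    qed
    then show ?thesis using True by simp
  next
    case False
    then have "X > 0" using XY by simp
    moreover from this have "(Z / X)\<^sup>2 * X = Z\<^sup>2 / X" "2 * (Z / X) * Z = 2 * (Z\<^sup>2 / X)"
      by (simp_all add: power2_eq_square)
    ultimately have "Z\<^sup>2 / X \<le> Y" using q[of "Z / X"] by linarith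
    then show ?thesis using \<open>X > 0\<close> by (simp add: pos_divide_le_eq mult.commute)
  qed
  then have "\<bar>Z\<bar> \<le> sqrt (X * Y)" by (simp add: real_le_rsqrt)
  then show ?thesis by (simp add: real_sqrt_mult X_def Y_def Z_def)
qed

section \<open>The norms\<close>

lemma Lp_norm_2: "Lp_norm 2 f = sqrt (LINT t|lebesgue. (f t)\<^sup>2)"
proof -
  have "\<bar>x\<bar> powr 2 = x\<^sup>2" for x :: real by (cases "x = 0") auto
  then show ?thesis by (simp add: Lp_norm_def powr_half_sqrt)
qed

lemma Lp_norm_4: "(Lp_norm 4 f)\<^sup>2 = sqrt (LINT t|lebesgue. (f t) ^ 4)"
proof -
  have "\<bar>x\<bar> powr 4 = x ^ 4" for x :: real by (cases "x = 0") auto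
  then have "(Lp_norm 4 f)\<^sup>2 = ((LINT t|lebesgue. (f t) ^ 4) powr (1 / 4))\<^sup>2"
    by (simp add: Lp_norm_def)
  also have "\<dots> = (LINT t|lebesgue. (f t) ^ 4) powr (1 / 2)"
    by (simp add: power2_eq_square flip: powr_add)
  finally show ?thesis by (simp add: powr_half_sqrt)
qed

lemma Lp_norm_cong_AE:
  assumes "f \<in> borel_measurable lebesgue" "AE t in lebesgue. f t = g t"
  shows "Lp_norm r f = Lp_norm r g"
proof -
  have [measurable]: "g \<in> borel_measurable lebesgue" "f \<in> borel_measurable lebesgue"
    using assms borel_measurable_AE by blast+
  have "(LINT t|lebesgue. \<bar>f t\<bar> powr r) = (LINT t|lebesgue. \<bar>g t\<bar> powr r)"
    by (rule integral_cong_AE) (use assms(2) in \<open>auto\<close>)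
  then show ?thesis by (simp add: Lp_norm_def)
qed

text \<open>\<open>real_of_ereal\<close> maps both infinities to 0, so they have to be excluded:
  positive infinity by \<open>B\<close>, negative infinity because the essential bound is attained
  by some point, the line not being null.\<close>

lemma Linf_norm_finite:
  assumes f: "f \<in> borel_measurable lebesgue" and B: "AE t in lebesgue. \<bar>f t\<bar> \<le> B"
  shows "0 \<le> real_of_ereal (Linf_norm f)" "AE t in lebesgue. \<bar>f t\<bar> \<le> real_of_ereal (Linf_norm f)"
proof -
  have "Linf_norm f \<le> ereal B"
    unfolding Linf_norm_def by (rule esssup_I) (use f B in auto)
  moreover have le: "AE t in lebesgue. ereal \<bar>f t\<bar> \<le> Linf_norm f"
    unfolding Linf_norm_def by (rule esssup_AE)
  moreover have "\<exists>t. ereal \<bar>f t\<bar> \<le> Linf_norm f"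
    using eventually_mono[OF le, of "\<lambda>_. False"] not_AE_lebesgue_False by blast
  ultimately obtain l where l: "Linf_norm f = ereal l" "0 \<le> l"
    by (cases "Linf_norm f") (auto intro: order_trans[OF abs_ge_zero])
  then show "0 \<le> real_of_ereal (Linf_norm f)" by simp
  show "AE t in lebesgue. \<bar>f t\<bar> \<le> real_of_ereal (Linf_norm f)" using le l by simp
qed

text \<open>The embedding of H^1 into bounded functions: the derivative \<open>2 * F * f\<close> of
  the square of \<open>F\<close> is integrable, so that square is bounded.\<close>

lemma primitive_square_integrable_bounded:
  assumes P: "primitive F f" and F: "square_integrable F" and f: "square_integrable f"
  obtains B where "\<And>x. \<bar>F x\<bar> \<le> B"
proof -
  have "integrable lebesgue (\<lambda>t. F t * f t + f t * F t)"
    using integrable_mult_square_integrable[OF F f] by (simp add: mult.commute)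
  from primitive_bounded[OF primitive_mult[OF P P] this]
  obtain B where B: "\<And>x. \<bar>F x * F x\<bar> \<le> B" by blast
  have "\<bar>F x\<bar> \<le> 1 + B" for x
  proof -
    have "0 \<le> (\<bar>F x\<bar> - 1)\<^sup>2" by simp
    then have "2 * \<bar>F x\<bar> \<le> 1 + F x * F x" by (simp add: power2_diff flip: power2_eq_square)
    moreover have "F x * F x \<le> B" using B[of x] by linarith
    ultimately show ?thesis by linarith
  qed
  then show ?thesis using that by blast
qed

text \<open>The mean value inequality on \<open>{-B..B}\<close>. The bounds linear in
  \<open>x\<close> pass square-integrability from \<open>A\<close> to \<open>sinh (2 * A)\<close>
  and \<open>cosh (2 * A) - 1\<close>.\<close>

lemma sinh_cosh_linear_bound:
  fixes x :: real
  assumes "\<bar>x\<bar> \<le> B"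
  shows "\<bar>sinh x\<bar> \<le> cosh B * \<bar>x\<bar>" "\<bar>cosh x - 1\<bar> \<le> cosh B * \<bar>x\<bar>" "\<bar>sinh x\<bar> \<le> cosh B" "\<bar>cosh x\<bar> \<le> cosh B"
proof -
  have c: "\<bar>cosh y\<bar> \<le> cosh B" "\<bar>sinh y\<bar> \<le> cosh B" if "\<bar>y\<bar> \<le> B" for y
  proof -
    have "cosh y = cosh \<bar>y\<bar>" by (simp add: abs_if)
    also have "\<dots> \<le> cosh B" using that by (subst cosh_real_nonneg_le_iff) auto
    finally show 1: "\<bar>cosh y\<bar> \<le> cosh B" by simp
    have "\<bar>sinh y\<bar> \<le> cosh y"
      using sinh_less_cosh_real[of y] sinh_less_cosh_real[of "-y"] by (simp add: abs_le_iff)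
    then show "\<bar>sinh y\<bar> \<le> cosh B" using 1 by simp
  qed
  then show "\<bar>sinh x\<bar> \<le> cosh B" "\<bar>cosh x\<bar> \<le> cosh B" using assms by blast+
  have B: "x \<in> {-B..B}" "0 \<in> {-B..B}" using assms by (auto simp: abs_le_iff)
  have "norm (sinh x - sinh 0) \<le> cosh B * norm (x - 0)"
    by (rule field_differentiable_bound[of "{-B..B}" sinh cosh])
      (use B c(1) in \<open>auto intro!: derivative_eq_intros simp: abs_le_iff\<close>)
  then show "\<bar>sinh x\<bar> \<le> cosh B * \<bar>x\<bar>" by simp
  have "norm (cosh x - cosh 0) \<le> cosh B * norm (x - 0)"
    by (rule field_differentiable_bound[of "{-B..B}" cosh sinh])
      (use B c(2) in \<open>auto intro!: derivative_eq_intros simp: abs_le_iff\<close>)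
  then show "\<bar>cosh x - 1\<bar> \<le> cosh B * \<bar>x\<bar>" by simp
qed

section \<open>The energy estimate\<close>

text \<open>The continuous \<open>p\<close> is chosen before \<open>A\<close>, so \<open>A\<close>
  is a primitive of a continuous function and hence continuously differentiable.\<close>

lemma sobolev_H2_representative:
  assumes "sobolev_H 2 a"
  obtains A p h where "primitive A p" "primitive p h" "AE t in lebesgue. a t = A t" "has_weak_deriv a p"
    "square_integrable A" "square_integrable p" "square_integrable h"
proof -
  from assms obtain g h where a: "square_integrable a" "has_weak_deriv a g"
    and g: "square_integrable g" "has_weak_deriv g h" and h: "square_integrable h"
    by (auto simp: numeral_2_eq_2)
  obtain p where p: "primitive p h" "AE t in lebesgue. g t = p t"
    using has_weak_deriv_imp_primitive[OF g(2)] by blast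
  have ap: "has_weak_deriv a p"
    by (rule has_weak_deriv_cong_AE[OF a(2) _ p(2)]) simp
  obtain A where A: "primitive A p" "AE t in lebesgue. a t = A t"
    using has_weak_deriv_imp_primitive[OF ap] by blast
  show ?thesis
    using that[OF A(1) p(1) A(2) ap square_integrable_cong_AE[OF a(1) A(2)]
      square_integrable_cong_AE[OF g(1) p(2)] h] .
qed

text \<open>The last two squares add up to the squared distance from \<open>m\<close> to the complex
  number \<open>m * c + i * p\<close> rotated by the angle \<open>2 * d\<close>. Rotation preserves
  the modulus, so \<open>d\<close> enters only through the cross term.\<close>

lemma energy_density_identity:
  fixes m c s p d d' :: real
  shows "(d' + m * s)\<^sup>2 + (m * c * cos (2 * d) - p * sin (2 * d) - m)\<^sup>2
      + (m * c * sin (2 * d) + p * cos (2 * d))\<^sup>2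
    = (m * s)\<^sup>2 + (m * c - m)\<^sup>2 + p\<^sup>2 + d'\<^sup>2 + 2 * m * s * d'
      + 2 * m\<^sup>2 * c * (1 - cos (2 * d)) + 2 * m * p * sin (2 * d)"
proof -
  define C S where "C = cos (2 * d)" and "S = sin (2 * d)"
  have "S\<^sup>2 = 1 - C\<^sup>2" unfolding C_def S_def by (rule sin_squared_eq)
  then have "(m * c)\<^sup>2 * S\<^sup>2 = (m * c)\<^sup>2 * (1 - C\<^sup>2)" "p\<^sup>2 * S\<^sup>2 = p\<^sup>2 * (1 - C\<^sup>2)" by simp_all
  then show ?thesis unfolding C_def[symmetric] S_def[symmetric]
    by (simp add: power2_eq_square algebra_simps)
qed

text \<open>From \<open>E = p * (c - 1)\<close> one gets \<open>p * E = c * p * E - E^2\<close>.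
  This splits the terms linear in \<open>e\<close> into \<open>s * E' + 2 * c * p * E\<close>, which
  will be the derivative of \<open>s * E\<close>, and the gain
  \<open>- 4 * m * e * E^2\<close>.\<close>

lemma energy_density_bound:
  fixes m A p s c e E E' :: real
  assumes "m > 0" "c \<ge> 0" "E = p * (c - 1)"
  shows "(e * E' + m * s)\<^sup>2 + (m * c * cos (2 * (e * E)) - p * sin (2 * (e * E)) - m)\<^sup>2
      + (m * c * sin (2 * (e * E)) + p * cos (2 * (e * E)))\<^sup>2
    \<le> ((m * s)\<^sup>2 + (m * c - m)\<^sup>2 + p\<^sup>2) + e\<^sup>2 * E'\<^sup>2 + 2 * m * e * (s * E' + 2 * c * p * E)
      - 4 * m * e * E\<^sup>2 + 4 * m\<^sup>2 * e\<^sup>2 * (c * E\<^sup>2) + 4 * m * e\<^sup>2 * (\<bar>p\<bar> * E\<^sup>2)"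
proof -
  define d where "d = e * E"
  have "2 * m\<^sup>2 * c * (1 - cos (2 * d)) \<le> 2 * m\<^sup>2 * c * (2 * d\<^sup>2)"
    by (intro mult_left_mono one_minus_cos_double_bound) (use assms in auto)
  moreover have "2 * m * p * sin (2 * d) \<le> 2 * m * p * (2 * d) + 2 * m * \<bar>p\<bar> * (2 * d\<^sup>2)"
  proof -
    have "\<bar>sin (2 * d) - 2 * d\<bar> \<le> 2 * d\<^sup>2"
      using sin_minus_self_bound[of "2 * d"] by (simp add: power_mult_distrib)
    then have "\<bar>p\<bar> * \<bar>sin (2 * d) - 2 * d\<bar> \<le> \<bar>p\<bar> * (2 * d\<^sup>2)" by (rule mult_left_mono) simp
    then have "p * (sin (2 * d) - 2 * d) \<le> \<bar>p\<bar> * (2 * d\<^sup>2)"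
      by (metis abs_ge_self abs_mult order_trans)
    then have "2 * m * (p * (sin (2 * d) - 2 * d)) \<le> 2 * m * (\<bar>p\<bar> * (2 * d\<^sup>2))"
      using assms(1) by (intro mult_left_mono) auto
    then show ?thesis by (simp add: algebra_simps)
  qed
  moreover have "2 * m * s * (e * E') + 2 * m\<^sup>2 * c * (2 * d\<^sup>2) + 2 * m * p * (2 * d) + 2 * m * \<bar>p\<bar> * (2 * d\<^sup>2)
      = 2 * m * e * (s * E' + 2 * c * p * E)
      - 4 * m * e * E\<^sup>2 + 4 * m\<^sup>2 * e\<^sup>2 * (c * E\<^sup>2) + 4 * m * e\<^sup>2 * (\<bar>p\<bar> * E\<^sup>2)"
  proof -
    have "m * e * E\<^sup>2 = m * e * c * p * E - m * e * p * E"
      by (simp add: assms(3) power2_eq_square algebra_simps)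
    then show ?thesis by (simp add: d_def power_mult_distrib algebra_simps)
  qed
  ultimately show ?thesis
    unfolding energy_density_identity d_def[symmetric] power_mult_distrib[of e E'] by linarith
qed

text \<open>The setting for pointwise work: the original \<open>a\<close> enters only in
  \<open>energy_eq\<close> and in the final theorem, by equality almost everywhere.\<close>

locale H2_representative =
  fixes A p h :: "real \<Rightarrow> real"
  assumes A: "primitive A p" and p: "primitive p h"
    and sqA: "square_integrable A" and sqp: "square_integrable p" and sqh: "square_integrable h"
begin

definition c where "c t = cosh (2 * A t)"
definition s where "s t = sinh (2 * A t)"
definition E where "E t = p t * (c t - 1)"
definition E' where "E' t = p t * (2 * p t * s t) + h t * (c t - 1)"

lemma c_ge_1: "c t \<ge> 1" by (simp add: c_def cosh_real_ge_1)

lemma continuous_data: "continuous_on UNIV A" "continuous_on UNIV p" "continuous_on UNIV c" "continuous_on UNIV s"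
  using primitive_continuous[OF A] primitive_continuous[OF p]
  unfolding c_def[abs_def] s_def[abs_def] by (auto intro!: continuous_intros)

lemma measurable_data [measurable]:
  "A \<in> borel_measurable lebesgue" "p \<in> borel_measurable lebesgue" "c \<in> borel_measurable lebesgue"
  "s \<in> borel_measurable lebesgue" "h \<in> borel_measurable lebesgue"
  "E \<in> borel_measurable lebesgue" "E' \<in> borel_measurable lebesgue"
proof -
  show m: "A \<in> borel_measurable lebesgue" "p \<in> borel_measurable lebesgue" "c \<in> borel_measurable lebesgue"
    "s \<in> borel_measurable lebesgue" "h \<in> borel_measurable lebesgue"
    using continuous_data borel_measurable_lebesgue_continuous square_integrableD(1)[OF sqh] by blast+
  show "E \<in> borel_measurable lebesgue" "E' \<in> borel_measurable lebesgue"
    unfolding E_def[abs_def] E'_def[abs_def] using m by auto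
qed

lemma primitive_c: "primitive c (\<lambda>t. 2 * p t * s t)" and primitive_s: "primitive s (\<lambda>t. 2 * p t * c t)"
proof -
  note d = primitive_has_derivative[OF A continuous_data(2)]
  show "primitive c (\<lambda>t. 2 * p t * s t)"
    by (rule primitive_if_has_derivative)
      (auto simp: c_def[abs_def] s_def intro!: derivative_eq_intros d continuous_intros continuous_data(1,2))
  show "primitive s (\<lambda>t. 2 * p t * c t)"
    by (rule primitive_if_has_derivative)
      (auto simp: s_def[abs_def] c_def intro!: derivative_eq_intros d continuous_intros continuous_data(1,2))
qed

text \<open>The classical rules suffice for \<open>c\<close> and \<open>s\<close>, but
  \<open>p\<close> has only the square-integrable derivative \<open>h\<close>; hence the product
  rule for primitives.\<close>

lemma primitive_E: "primitive E E'"
proof -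
  have "primitive (\<lambda>t. c t + (-1) * 1) (\<lambda>t. 2 * p t * s t + (-1) * 0)"
    by (rule primitive_lincomb[OF primitive_c primitive_const])
  from primitive_mult[OF p this] show ?thesis
    by (simp add: E_def[abs_def] E'_def[abs_def])
qed

lemma bounds:
  obtains K where "K \<ge> 0" "\<And>t. \<bar>c t\<bar> \<le> K" "\<And>t. \<bar>s t\<bar> \<le> K" "\<And>t. \<bar>p t\<bar> \<le> K"
    "\<And>t. \<bar>c t - 1\<bar> \<le> K * \<bar>A t\<bar>" "\<And>t. \<bar>s t\<bar> \<le> K * \<bar>A t\<bar>" "\<And>t. \<bar>c t - 1\<bar> \<le> K" "\<And>t. \<bar>E t\<bar> \<le> K"
proof -
  obtain B where B: "\<And>x. \<bar>A x\<bar> \<le> B" using primitive_square_integrable_bounded[OF A sqA sqp] by blast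
  obtain P where P: "\<And>x. \<bar>p x\<bar> \<le> P" using primitive_square_integrable_bounded[OF p sqp sqh] by blast
  define C where "C = cosh (2 * B)"
  have C1: "C \<ge> 1" by (simp add: C_def cosh_real_ge_1)
  have P0: "P \<ge> 0" using P[of 0] by linarith
  have bd: "\<bar>2 * A t\<bar> \<le> 2 * B" for t using B[of t] by simp
  note b = sinh_cosh_linear_bound[OF bd, folded C_def c_def s_def]
  \<comment> \<open>One constant for all the bounds: \<open>2 * C\<close> pays for the argument
    \<open>2 * A\<close> in the linear ones, \<open>P * (1 + C)\<close> bounds
    \<open>E\<close>.\<close>
  define K where "K = 2 * C + P + P * (1 + C)"
  have PC: "P * (1 + C) \<ge> 0" using P0 C1 by simp
  have K: "C \<le> K" "2 * C \<le> K" "P \<le> K" "1 + C \<le> K" "P * (1 + C) \<le> K"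
    using C1 P0 PC unfolding K_def by linarith+
  have c1: "\<bar>c t - 1\<bar> \<le> 1 + C" for t using b(4)[of t] by linarith
  have lin: "C * \<bar>2 * A t\<bar> \<le> K * \<bar>A t\<bar>" for t
    using mult_right_mono[OF K(2), of "\<bar>A t\<bar>"] by (simp add: abs_mult)
  show ?thesis
  proof (rule that[of K])
    show "\<bar>E t\<bar> \<le> K" for t
    proof -
      have "\<bar>E t\<bar> \<le> P * (1 + C)"
        unfolding E_def abs_mult by (intro mult_mono P c1) (use P0 in auto)
      then show ?thesis using K(5) by linarith
    qed
    show "\<bar>c t\<bar> \<le> K" for t using b(4)[of t] K(1) by linarith
    show "\<bar>s t\<bar> \<le> K" for t using b(3)[of t] K(1) by linarith
    show "\<bar>p t\<bar> \<le> K" for t using P[of t] K(3) by linarith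
    show "\<bar>c t - 1\<bar> \<le> K" for t using c1[of t] K(4) by linarith
    show "\<bar>c t - 1\<bar> \<le> K * \<bar>A t\<bar>" for t using b(2)[of t] lin[of t] by linarith
    show "\<bar>s t\<bar> \<le> K * \<bar>A t\<bar>" for t using b(1)[of t] lin[of t] by linarith
    show "K \<ge> 0" using K(3) P0 by linarith
  qed
qed

text \<open>Each product pairs a bounded factor with a square-integrable one. The last claim is
  integrability of \<open>E^4\<close>, behind the L^4 norm.\<close>

lemma square_integrable_data:
  "square_integrable s" "square_integrable (\<lambda>t. c t - 1)" "square_integrable E" "square_integrable E'"
  "square_integrable (\<lambda>t. (E t)\<^sup>2)"
proof -
  obtain K where K: "K \<ge> 0" "\<And>t. \<bar>c t\<bar> \<le> K" "\<And>t. \<bar>s t\<bar> \<le> K" "\<And>t. \<bar>p t\<bar> \<le> K"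
    "\<And>t. \<bar>c t - 1\<bar> \<le> K * \<bar>A t\<bar>" "\<And>t. \<bar>s t\<bar> \<le> K * \<bar>A t\<bar>" "\<And>t. \<bar>c t - 1\<bar> \<le> K" "\<And>t. \<bar>E t\<bar> \<le> K"
    using bounds by blast
  have m: "(\<lambda>t. c t - 1) \<in> borel_measurable lebesgue" by simp
  show "square_integrable s" by (rule square_integrable_bound[OF sqA _ K(6)]) simp
  show "square_integrable (\<lambda>t. c t - 1)" by (rule square_integrable_bound[OF sqA m K(5)])
  have "square_integrable (\<lambda>t. (c t - 1) * p t)" by (rule square_integrable_mult_bounded[OF sqp m K(7)])
  then show E: "square_integrable E" by (simp add: E_def[abs_def] mult.commute)
  have "square_integrable (\<lambda>t. (2 * p t * s t) * p t)"
  proof (rule square_integrable_mult_bounded[OF sqp])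
    show "\<bar>2 * p t * s t\<bar> \<le> 2 * (K * K)" for t
      using mult_mono[OF K(4)[of t] K(3)[of t]] K(1) by (simp add: abs_mult)
  qed simp
  from square_integrable_add[OF this square_integrable_mult_bounded[OF sqh m K(7)]]
  show "square_integrable E'" by (simp add: E'_def[abs_def] mult.commute)
  have "square_integrable (\<lambda>t. E t * E t)" by (rule square_integrable_mult_bounded[OF E _ K(8)]) simp
  then show "square_integrable (\<lambda>t. (E t)\<^sup>2)" by (simp add: power2_eq_square)
qed

text \<open>The integrand is the product-rule derivative of \<open>s * E\<close>; both are
  integrable, so \<open>integral_primitive_eq_0\<close> applies.\<close>

lemma integral_cross_term:
  "integrable lebesgue (\<lambda>t. s t * E' t + 2 * c t * p t * E t)"
  "(LINT t|lebesgue. s t * E' t + 2 * c t * p t * E t) = 0"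
proof -
  obtain K where K: "K \<ge> 0" "\<And>t. \<bar>c t\<bar> \<le> K" using bounds by metis
  have "integrable lebesgue (\<lambda>t. c t * (p t * E t))"
    by (rule integrable_mult_bounded[OF _ _ K(2)]) (simp_all add: integrable_mult_square_integrable sqp square_integrable_data)
  then have "integrable lebesgue (\<lambda>t. 2 * (c t * (p t * E t)))" by simp
  then have i2: "integrable lebesgue (\<lambda>t. 2 * c t * p t * E t)" by (simp only: mult.assoc)
  have i1: "integrable lebesgue (\<lambda>t. s t * E' t)"
    by (intro integrable_mult_square_integrable square_integrable_data)
  show i: "integrable lebesgue (\<lambda>t. s t * E' t + 2 * c t * p t * E t)"
    by (rule Bochner_Integration.integrable_add[OF i1 i2])
  have "primitive (\<lambda>t. s t * E t) (\<lambda>t. s t * E' t + 2 * c t * p t * E t)"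
    using primitive_mult[OF primitive_s primitive_E] by (simp add: mult_ac)
  then show "(LINT t|lebesgue. s t * E' t + 2 * c t * p t * E t) = 0"
    by (rule integral_primitive_eq_0[OF _ _ i]) (intro integrable_mult_square_integrable square_integrable_data)
qed

text \<open>The energy density of the phase \<open>e * E\<close>, parametrised by the amplitude so
  that \<open>e = 0\<close> covers the comparison phase.\<close>

definition edensity :: "real \<Rightarrow> real \<Rightarrow> real \<Rightarrow> real" where
  "edensity m e t = (e * E' t + m * s t)\<^sup>2 + (m * c t * cos (2 * (e * E t)) - p t * sin (2 * (e * E t)) - m)\<^sup>2
      + (m * c t * sin (2 * (e * E t)) + p t * cos (2 * (e * E t)))\<^sup>2"

lemma edensity_nonneg: "edensity m e t \<ge> 0" by (simp add: edensity_def)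

text \<open>This makes the energy of the zero phase finite, so that the final comparison is one of
  real numbers.\<close>

lemma integrable_edensity_0: "integrable lebesgue (edensity m 0)"
proof -
  have "edensity m 0 = (\<lambda>t. m\<^sup>2 * (s t)\<^sup>2 + m\<^sup>2 * (c t - 1)\<^sup>2 + (p t)\<^sup>2)"
    by (auto simp: edensity_def power2_eq_square algebra_simps)
  then show ?thesis
    using square_integrableD(2)[OF square_integrable_data(1)] square_integrableD(2)[OF square_integrable_data(2)]
      square_integrableD(2)[OF sqp] by simp
qed

lemma integral_edensity_bound:
  assumes m: "m > 0" and L: "AE t in lebesgue. c t \<le> L"
  shows "integrable lebesgue (edensity m e)"
    "(LINT t|lebesgue. edensity m e t) \<le> (LINT t|lebesgue. edensity m 0 t)
      + e\<^sup>2 * (LINT t|lebesgue. (E' t)\<^sup>2) - 4 * m * e * (LINT t|lebesgue. (E t)\<^sup>2)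
      + 4 * m\<^sup>2 * e\<^sup>2 * (L * (LINT t|lebesgue. (E t)\<^sup>2))
      + 4 * m * e\<^sup>2 * (sqrt (LINT t|lebesgue. (p t)\<^sup>2) * sqrt (LINT t|lebesgue. (E t) ^ 4))"
proof -
  \<comment> \<open>A pointwise majorant, equal to the density at \<open>e = 0\<close> plus
    integrable terms; it yields both the integrability and the bound.\<close>
  define G where "G = (\<lambda>t. edensity m 0 t + e\<^sup>2 * (E' t)\<^sup>2 + 2 * m * e * (s t * E' t + 2 * c t * p t * E t)
      - 4 * m * e * (E t)\<^sup>2 + 4 * m\<^sup>2 * e\<^sup>2 * (c t * (E t)\<^sup>2) + 4 * m * e\<^sup>2 * (\<bar>p t\<bar> * (E t)\<^sup>2))"
  have le: "edensity m e t \<le> G t" for t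
    using energy_density_bound[of m "c t" "E t" "p t" e "E' t" "s t"] m c_ge_1[of t]
    by (simp add: G_def edensity_def E_def)
  obtain K where K: "\<And>t. \<bar>c t\<bar> \<le> K" using bounds by metis
  have absp: "square_integrable (\<lambda>t. \<bar>p t\<bar>)" using sqp by (simp add: square_integrable_def)
  note iE = square_integrableD(2)[OF square_integrable_data(3)] and iE' = square_integrableD(2)[OF square_integrable_data(4)]
  have icE: "integrable lebesgue (\<lambda>t. c t * (E t)\<^sup>2)"
    by (rule integrable_mult_bounded[OF iE _ K]) simp
  have ipE: "integrable lebesgue (\<lambda>t. \<bar>p t\<bar> * (E t)\<^sup>2)"
    by (rule integrable_mult_square_integrable[OF absp square_integrable_data(5)])
  note i = integrable_edensity_0[of m] iE iE' icE ipE integral_cross_term(1)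
  have iG: "integrable lebesgue G" unfolding G_def using i by simp
  have [measurable]: "edensity m e \<in> borel_measurable lebesgue"
    unfolding edensity_def[abs_def] by measurable
  show iD: "integrable lebesgue (edensity m e)"
  proof (rule Bochner_Integration.integrable_bound[OF iG])
    show "AE t in lebesgue. norm (edensity m e t) \<le> norm (G t)"
      using le edensity_nonneg[of m e] by (auto intro: order_trans[OF _ abs_ge_self])
  qed simp
  have "(LINT t|lebesgue. edensity m e t) \<le> (LINT t|lebesgue. G t)"
    by (rule integral_mono[OF iD iG le])
  also have "\<dots> = (LINT t|lebesgue. edensity m 0 t) + e\<^sup>2 * (LINT t|lebesgue. (E' t)\<^sup>2)
      + 2 * m * e * (LINT t|lebesgue. s t * E' t + 2 * c t * p t * E t)
      - 4 * m * e * (LINT t|lebesgue. (E t)\<^sup>2) + 4 * m\<^sup>2 * e\<^sup>2 * (LINT t|lebesgue. c t * (E t)\<^sup>2)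
      + 4 * m * e\<^sup>2 * (LINT t|lebesgue. \<bar>p t\<bar> * (E t)\<^sup>2)"
    unfolding G_def using i by simp
  also have "\<dots> \<le> (LINT t|lebesgue. edensity m 0 t) + e\<^sup>2 * (LINT t|lebesgue. (E' t)\<^sup>2)
      - 4 * m * e * (LINT t|lebesgue. (E t)\<^sup>2)
      + 4 * m\<^sup>2 * e\<^sup>2 * (L * (LINT t|lebesgue. (E t)\<^sup>2))
      + 4 * m * e\<^sup>2 * (sqrt (LINT t|lebesgue. (p t)\<^sup>2) * sqrt (LINT t|lebesgue. (E t) ^ 4))"
  proof -
    have "(LINT t|lebesgue. c t * (E t)\<^sup>2) \<le> (LINT t|lebesgue. L * (E t)\<^sup>2)"
    proof (rule integral_mono_AE)
      show "AE t in lebesgue. c t * (E t)\<^sup>2 \<le> L * (E t)\<^sup>2"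
        using L by eventually_elim (auto intro: mult_right_mono)
    qed (use icE iE in auto)
    then have "4 * m\<^sup>2 * e\<^sup>2 * (LINT t|lebesgue. c t * (E t)\<^sup>2) \<le> 4 * m\<^sup>2 * e\<^sup>2 * (L * (LINT t|lebesgue. (E t)\<^sup>2))"
      by (intro mult_left_mono) auto
    moreover have "(LINT t|lebesgue. \<bar>p t\<bar> * (E t)\<^sup>2)
        \<le> sqrt (LINT t|lebesgue. (p t)\<^sup>2) * sqrt (LINT t|lebesgue. (E t) ^ 4)"
      using Cauchy_Schwarz_integral[OF absp square_integrable_data(5)] by simp
    then have "4 * m * e\<^sup>2 * (LINT t|lebesgue. \<bar>p t\<bar> * (E t)\<^sup>2)
        \<le> 4 * m * e\<^sup>2 * (sqrt (LINT t|lebesgue. (p t)\<^sup>2) * sqrt (LINT t|lebesgue. (E t) ^ 4))"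
      using m by (intro mult_left_mono) auto
    ultimately show ?thesis unfolding integral_cross_term(2) by simp
  qed
  finally show "(LINT t|lebesgue. edensity m e t) \<le> (LINT t|lebesgue. edensity m 0 t)
      + e\<^sup>2 * (LINT t|lebesgue. (E' t)\<^sup>2) - 4 * m * e * (LINT t|lebesgue. (E t)\<^sup>2)
      + 4 * m\<^sup>2 * e\<^sup>2 * (L * (LINT t|lebesgue. (E t)\<^sup>2))
      + 4 * m * e\<^sup>2 * (sqrt (LINT t|lebesgue. (p t)\<^sup>2) * sqrt (LINT t|lebesgue. (E t) ^ 4))" .
qed

text \<open>The densities agree only almost everywhere, \<open>weak_deriv\<close> being an arbitrary
  representative. Integrability turns the non-negative integral into a real one.\<close>

lemma energy_eq:
  assumes a: "AE t in lebesgue. a t = A t" "has_weak_deriv a p"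
    and d: "AE t in lebesgue. d t = e * E t"
    and int: "integrable lebesgue (edensity m e)"
  shows "energy m a d = ereal (2 * (LINT t|lebesgue. edensity m e t))"
proof -
  have "primitive (\<lambda>t. 0 + e * E t) (\<lambda>t. 0 + e * E' t)"
    by (rule primitive_lincomb[OF primitive_const primitive_E])
  then have "has_weak_deriv (\<lambda>t. e * E t) (\<lambda>t. e * E' t)"
    by (simp add: has_weak_deriv_if_primitive)
  moreover have "AE t in lebesgue. e * E t = d t" using d by eventually_elim simp
  ultimately have "has_weak_deriv d (\<lambda>t. e * E' t)"
    by (rule has_weak_deriv_cong_AE) simp
  note wd = weak_deriv_AE_eq[OF this] weak_deriv_AE_eq[OF a(2)]
  have "(\<integral>\<^sup>+ t. ennreal ((weak_deriv d t + m * sinh (2 * a t))\<^sup>2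
     + (m * cosh (2 * a t) * cos (2 * d t) - weak_deriv a t * sin (2 * d t) - m)\<^sup>2
     + (m * cosh (2 * a t) * sin (2 * d t) + weak_deriv a t * cos (2 * d t))\<^sup>2) \<partial>lebesgue)
     = (\<integral>\<^sup>+ t. ennreal (edensity m e t) \<partial>lebesgue)"
    by (rule nn_integral_cong_AE) (use wd a(1) d in eventually_elim, simp add: edensity_def c_def s_def)
  also have "\<dots> = ennreal (LINT t|lebesgue. edensity m e t)"
    by (rule nn_integral_eq_integral[OF int]) (simp add: edensity_nonneg)
  finally show ?thesis
    by (simp add: energy_def enn2ereal_ennreal integral_nonneg_AE edensity_nonneg)
qed

end

section \<open>Transfer to the given function and choice of the amplitude\<close>

theorem proposition7p4:
  fixes m :: real and a :: "real \<Rightarrow> real"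
  assumes "m > 0"
    and "sobolev_H 2 a"
    and "A_const a > 0"
  shows "sobolev_H1_loc (delta m a)
    \<and> Linf_norm (delta m a) \<le> ereal (pi / 4)
    \<and> energy m a (delta m a)
        \<le> energy m a (\<lambda>t. 0) - ereal (6 * m * A_const a * eps_const m a)"
proof -
  obtain A p h where rep: "primitive A p" "primitive p h"
      "square_integrable A" "square_integrable p" "square_integrable h"
    and aA: "AE t in lebesgue. a t = A t" and ap: "has_weak_deriv a p"
    using sobolev_H2_representative[OF assms(2)] by metis
  interpret H2_representative A p h by standard (fact rep)+
  have wa: "AE t in lebesgue. weak_deriv a t = p t" by (rule weak_deriv_AE_eq[OF ap])
  have cc: "AE t in lebesgue. c t = c_fun a t"
    using aA by eventually_elim (simp add: c_def c_fun_def)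
  have Eeta: "AE t in lebesgue. E t = eta a t"
    using wa cc by eventually_elim (simp add: E_def eta_def)
  have m_eta: "eta a \<in> borel_measurable lebesgue" and m_c: "c_fun a \<in> borel_measurable lebesgue"
    using borel_measurable_AE measurable_data Eeta cc by blast+
  have weta: "has_weak_deriv (eta a) E'"
    by (rule has_weak_deriv_cong_AE[OF has_weak_deriv_if_primitive[OF primitive_E] Eeta]) simp
  have E'eta: "AE t in lebesgue. E' t = weak_deriv (eta a) t"
    using weak_deriv_AE_eq[OF weta] by eventually_elim simp
  have pa: "AE t in lebesgue. p t = weak_deriv a t" using wa by eventually_elim simp
  define X where "X = (LINT t|lebesgue. (E t)\<^sup>2)"
  define Y where "Y = (LINT t|lebesgue. (E' t)\<^sup>2)"
  define W where "W = sqrt (LINT t|lebesgue. (p t)\<^sup>2) * sqrt (LINT t|lebesgue. (E t) ^ 4)"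
  define L where "L = real_of_ereal (Linf_norm (c_fun a))"
  define l where "l = real_of_ereal (Linf_norm (eta a))"
  define e where "e = eps_const m a"
  have norms: "Lp_norm 2 (eta a) = Lp_norm 2 E" "Lp_norm 4 (eta a) = Lp_norm 4 E"
      "Lp_norm 2 (weak_deriv (eta a)) = Lp_norm 2 E'" "Lp_norm 2 (weak_deriv a) = Lp_norm 2 p"
    using Lp_norm_cong_AE measurable_data Eeta E'eta pa by metis+
  have A_eq: "A_const a = X"
    unfolding A_const_def norms by (simp add: Lp_norm_2 X_def)
  have M_eq: "M_const m a = 2 * Y + 8 * m\<^sup>2 * L * X + 8 * m * W"
    unfolding M_const_def norms by (simp add: Lp_norm_2 Lp_norm_4 X_def Y_def W_def L_def)
  have X: "X > 0" using assms(3) A_eq by simp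
  obtain K where K: "\<And>t. \<bar>c t\<bar> \<le> K" "\<And>t. \<bar>E t\<bar> \<le> K" using bounds by metis
  have "AE t in lebesgue. \<bar>c_fun a t\<bar> \<le> K" using cc by eventually_elim (use K in metis)
  from Linf_norm_finite(2)[OF m_c this] have L: "AE t in lebesgue. c t \<le> L"
    using cc by eventually_elim (simp add: L_def)
  \<comment> \<open>Since \<open>c \<ge> 1\<close> everywhere, a smaller essential bound would make
    the line null. The middle term of \<open>M_const\<close> is thereby positive.\<close>
  have "L \<ge> 1"
  proof (rule ccontr)
    assume "\<not> L \<ge> 1"
    then have "AE t::real in lebesgue. False"
      by (intro eventually_mono[OF L]) (use c_ge_1 order_trans in blast)
    then show False using not_AE_lebesgue_False by blast
  qed
  have "AE t in lebesgue. \<bar>eta a t\<bar> \<le> K" using Eeta by eventually_elim (use K in metis)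
  note l = Linf_norm_finite[OF m_eta this, folded l_def]
  \<comment> \<open>Division by 0 gives 0, so \<open>l = 0\<close> would collapse the amplitude to
    0; it is excluded because \<open>E\<close> would then vanish almost everywhere, against
    \<open>X > 0\<close>.\<close>
  have "l \<noteq> 0"
  proof
    assume "l = 0"
    have "AE t in lebesgue. (E t)\<^sup>2 = 0"
      using l(2) Eeta by eventually_elim (simp add: \<open>l = 0\<close>)
    then have "X = 0" unfolding X_def by (rule integral_eq_zero_AE)
    then show False using X by simp
  qed
  then have l0: "l > 0" using l(1) by simp
  have M: "M_const m a > 0"
  proof -
    have "Y \<ge> 0" by (simp add: Y_def)
    moreover have "8 * m * W \<ge> 0" using assms(1) by (simp add: W_def)
    moreover have "8 * m\<^sup>2 * L * X > 0" using X \<open>L \<ge> 1\<close> assms(1) by simp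
    ultimately show ?thesis unfolding M_eq by linarith
  qed
  have e_def': "e = min (2 * m * X / M_const m a) (pi / (4 * l))"
    by (simp add: e_def eps_const_def A_eq l_def)
  have e0: "e > 0" unfolding e_def' using X M l0 assms(1) by simp
  have "e \<le> 2 * m * X / M_const m a" by (simp add: e_def')
  then have eM: "e * M_const m a \<le> 2 * m * X" using M by (simp add: pos_le_divide_eq)
  have "e \<le> pi / (4 * l)" by (simp add: e_def')
  then have el: "e * l \<le> pi / 4" using l0 by (simp add: pos_le_divide_eq field_simps)
  have delta: "delta m a = (\<lambda>t. e * eta a t)" by (simp add: delta_def[abs_def] e_def)
  have dE: "AE t in lebesgue. delta m a t = e * E t"
    using Eeta by eventually_elim (simp add: delta)
  have Ed: "AE t in lebesgue. e * E t = delta m a t"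
    using dE by eventually_elim simp

  have "square_integrable (delta m a)"
    by (rule square_integrable_cong_AE[OF square_integrable_cmult[OF square_integrable_data(3)] Ed])
  moreover have "has_weak_deriv (delta m a) (\<lambda>t. e * E' t)"
  proof (rule has_weak_deriv_cong_AE[OF has_weak_deriv_if_primitive])
    show "primitive (\<lambda>t. 0 + e * E t) (\<lambda>t. 0 + e * E' t)"
      by (rule primitive_lincomb[OF primitive_const primitive_E])
    show "AE t in lebesgue. 0 + e * E t = delta m a t" using Ed by simp
  qed simp
  ultimately have 1: "sobolev_H1_loc (delta m a)"
    unfolding sobolev_H1_loc_def
    using square_integrable_imp_loc square_integrable_cmult[OF square_integrable_data(4)] by blast

  have 2: "Linf_norm (delta m a) \<le> ereal (pi / 4)"
    unfolding Linf_norm_def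
  proof (rule esssup_I)
    show "(\<lambda>t. ereal \<bar>delta m a t\<bar>) \<in> borel_measurable lebesgue"
      unfolding delta using m_eta by simp
    show "AE t in lebesgue. ereal \<bar>delta m a t\<bar> \<le> ereal (pi / 4)"
      using l(2)
    proof eventually_elim
      case (elim t)
      then have "e * \<bar>eta a t\<bar> \<le> e * l" using e0 by simp
      then have "e * \<bar>eta a t\<bar> \<le> pi / 4" using el by linarith
      then show ?case using e0 by (simp add: delta abs_mult)
    qed
  qed

  note D = integral_edensity_bound[OF assms(1) L, of e, folded X_def Y_def W_def]
  have "energy m a (delta m a) = ereal (2 * (LINT t|lebesgue. edensity m e t))"
    by (rule energy_eq[OF aA ap dE D(1)])
  \<comment> \<open>The weak derivative of the zero phase is also chosen by \<open>SOME\<close> and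
    is 0 only almost everywhere, so \<open>energy_eq\<close> is used with amplitude 0.\<close>
  moreover have "energy m a (\<lambda>t. 0) = ereal (2 * (LINT t|lebesgue. edensity m 0 t))"
    by (rule energy_eq[OF aA ap _ integrable_edensity_0]) simp
  moreover have "2 * (LINT t|lebesgue. edensity m e t)
      \<le> 2 * (LINT t|lebesgue. edensity m 0 t) - 6 * m * X * e"
  proof -
    have "e * (e * M_const m a) \<le> e * (2 * m * X)" using eM e0 by simp
    then show ?thesis using D(2) unfolding M_eq by (simp add: power2_eq_square algebra_simps)
  qed
  ultimately have 3: "energy m a (delta m a)
      \<le> energy m a (\<lambda>t. 0) - ereal (6 * m * A_const a * eps_const m a)"
    by (simp add: A_eq e_def)
  from 1 2 3 show ?thesis by blast
qed

end
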